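(* Let $(k,|\cdot|)$ be an ultrametric field of positive characteristic, with ring of integers $\mathcal{O}_k$. Then for each parabolic power series $f(\zeta)$ in $\mathcal{O}_k[[\zeta]]$ that is minimally ramified, the origin is isolated as a periodic point of $f$; that is, there is $\varepsilon>0$ such that $f$ has no periodic point $\zeta_0$ in the maximal ideal of $\mathcal{O}_k$ with $0<|\zeta_0|<\varepsilon$.
   Context: Let $p$ be the characteristic of $k$. Powers of power series denote iterates under composition. A power series $f\in\mathcal{O}_k[[\zeta]]$ with $f(0)=0$ converges on the maximal ideal $\mathfrak{m}_k$ of $\mathcal{O}_k$ (values being taken in the completion of $k$ if $k$ is not complete) and maps the maximal ideal (of the completion) to itself; periodic points are understood for this action. For a nonzero power series in $k[[\zeta]]$, $\operatorname{ord}$ denotes the lowest degree of its nonzero terms, and $\operatorname{ord}(0)=+\infty$. For $g(\zeta)\in k[[\zeta]]$ with $g(0)=0$ and $g'(0)=1$, and each integer $n\ge 0$, put $i_n(g) := \operatorname{ord}\left(\frac{g^{p^n}(\zeta)-\zeta}{\zeta}\right)$. A power series $f(\zeta)\in k[[\zeta]]$ is parabolic if $f(0)=0$ and $f'(0)$ is a root of unity. If $q$ is the order of $f'(0)$, then $f^q(0)=0$, $(f^q)'(0)=1$, and $f$ is called minimally ramified if $i_n(f^q) = q\,\frac{p^{n+1}-1}{p-1}$ for every integer $n\ge 0$. *)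

theory Defs
  imports "HOL-Analysis.Analysis"
begin

text \<open>
  A field with a non-archimedean absolute value, which also induces the metric and the topology.
  Completeness and nontriviality are not assumed. A separate parameter is used for the absolute
  value because \<open>norm\<close> is constrained to real vector spaces, which have characteristic zero.
\<close>
class ultrametric_field = field + metric_space +
  fixes absv :: "'a \<Rightarrow> real"
  assumes absv_nonneg: "0 \<le> absv x"
    and absv_eq_0_iff: "absv x = 0 \<longleftrightarrow> x = 0"
    and absv_mult: "absv (x * y) = absv x * absv y"
    and absv_add_le_max: "absv (x + y) \<le> max (absv x) (absv y)"
    and dist_absv: "dist x y = absv (x - y)"

definition ring_of_integers :: "'a::ultrametric_field set" where
  "ring_of_integers = {x. absv x \<le> 1}"

definition maximal_ideal :: "'a::ultrametric_field set" where
  "maximal_ideal = {x. absv x < 1}"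

text \<open>
  The completion of a field is determined only up to a unique isometric isomorphism, so it is
  given here by its embedding \<open>\<iota>\<close> into a complete field.
\<close>
definition is_completion ::
  "('a::ultrametric_field \<Rightarrow> 'b::{ultrametric_field, complete_space}) \<Rightarrow> bool" where
  "is_completion \<iota> \<longleftrightarrow>
     \<iota> 1 = 1 \<and>
     (\<forall>x y. \<iota> (x + y) = \<iota> x + \<iota> y) \<and>
     (\<forall>x y. \<iota> (x * y) = \<iota> x * \<iota> y) \<and>
     (\<forall>x. absv (\<iota> x) = absv x) \<and>
     closure (range \<iota>) = UNIV"

text \<open>
  The sum converges for \<open>w\<close> in the maximal ideal if \<open>f\<close> has coefficients in the ring of integers.
\<close>
definition fps_action ::
  "('a::ultrametric_field \<Rightarrow> 'b::{ultrametric_field, complete_space}) \<Rightarrow> 'a fps \<Rightarrow> 'b \<Rightarrow> 'b" where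
  "fps_action \<iota> f w = (\<Sum>n. \<iota> (fps_nth f n) * w ^ n)"

definition periodic_point ::
  "('a::ultrametric_field \<Rightarrow> 'b::{ultrametric_field, complete_space}) \<Rightarrow> 'a fps \<Rightarrow> 'b \<Rightarrow> bool" where
  "periodic_point \<iota> f w \<longleftrightarrow>
     w \<in> maximal_ideal \<and> (\<exists>n\<ge>1. (fps_action \<iota> f ^^ n) w = w)"

text \<open>The \<open>n\<close>-th iterate under composition, as opposed to the multiplicative power \<open>f ^ n\<close>.\<close>
definition fps_iterate :: "'a::field fps \<Rightarrow> nat \<Rightarrow> 'a fps" where
  "fps_iterate f n = ((\<lambda>g. fps_compose f g) ^^ n) fps_X"

text \<open>Unlike \<^const>\<open>subdegree\<close>, this is infinite at \<open>0\<close>.\<close>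
definition fps_ord :: "'a::zero fps \<Rightarrow> enat" where
  "fps_ord f = (if f = 0 then \<infinity> else enat (subdegree f))"

definition ramification_number :: "nat \<Rightarrow> 'a::field fps \<Rightarrow> enat" where
  "ramification_number n g =
     fps_ord ((fps_iterate g (CHAR('a) ^ n) - fps_X) / fps_X)"

definition parabolic :: "'a::field fps \<Rightarrow> bool" where
  "parabolic f \<longleftrightarrow>
     fps_nth f 0 = 0 \<and> (\<exists>m\<ge>1. fps_nth (fps_deriv f) 0 ^ m = 1)"

definition multiplier_order :: "'a::field fps \<Rightarrow> nat" where
  "multiplier_order f = (LEAST m. 1 \<le> m \<and> fps_nth (fps_deriv f) 0 ^ m = 1)"

text \<open>
  The division of natural numbers below is exact.
\<close>
definition minimally_ramified :: "'a::field fps \<Rightarrow> bool" where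
  "minimally_ramified f \<longleftrightarrow>
     (let p = CHAR('a); q = multiplier_order f in
        \<forall>n. ramification_number n (fps_iterate f q) =
              enat (q * ((p ^ (n + 1) - 1) div (p - 1))))"

end

theory Submission
  imports Defs
begin

text \<open>
  Let \<open>g = f\<^sup>q\<close> and \<open>v\<^sub>n = g\<^bsup>p^n\<^esup> - X\<close>, with leading coefficient \<open>c\<^sub>n\<close> in degree
  \<open>i\<^sub>n + 1\<close>. With \<open>\<delta> \<phi> = \<phi> \<circ> g\<^bsup>p^n\<^esup> - \<phi>\<close>, characteristic \<open>p\<close> gives \<open>v\<^sub>n\<^sub>+\<^sub>1 = \<delta>\<^sup>p X\<close>, and up
  to terms of high order \<open>\<delta>\<close> is the derivation \<open>D = v\<^sub>n \<partial>\<close>. Now \<open>D\<^sup>p\<close> is a derivation commuting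
  with \<open>D\<close>, so \<open>D\<^sup>p = \<lambda> D\<close> with \<open>\<partial> \<lambda> = 0\<close>. Hence \<open>v\<^sub>n\<^sub>+\<^sub>1 \<approx> \<lambda> v\<^sub>n\<close>, and
  \<open>v\<^sub>n\<^sub>+\<^sub>2 \<approx> (\<lambda> D)\<^sup>p X = \<lambda>\<^sup>p \<lambda> v\<^sub>n\<close>. Minimal ramification makes the error terms negligible for
  \<open>n \<ge> 1\<close>, so the ratios \<open>r\<^sub>n = c\<^sub>n\<^sub>+\<^sub>1 / c\<^sub>n\<close> satisfy \<open>r\<^sub>n\<^sub>+\<^sub>1 = r\<^sub>n\<^sup>p\<close>.

  A point \<open>w\<close> near \<open>0\<close> that is periodic for \<open>g\<close> has minimal period a power \<open>p\<^bsup>n+1\<^esup>\<close> (or is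
  fixed). The points of its orbit are zeros of the integral series \<open>v\<^sub>n\<^sub>+\<^sub>1 / v\<^sub>n\<close>, which starts
  with \<open>r\<^sub>n\<close>; so \<open>|w|\<close> to the power \<open>p\<^bsup>n+1\<^esup>\<close> is at least \<open>|r\<^sub>n|\<close>, which is \<open>|r\<^sub>1|\<close> to the
  power \<open>p\<^bsup>n-1\<^esup>\<close>. This bounds \<open>|w|\<close> below independently of \<open>n\<close>.
\<close>

section \<open>Iterates of power series in characteristic \<open>p\<close>\<close>

unbundle no vec_syntax and fps_syntax

section \<open>Orders at the origin and formal difference quotients\<close>

lemma fps_X_power_dvd_iff:
  fixes f :: "'a::field fps"
  shows "fps_X ^ r dvd f \<longleftrightarrow> (\<forall>n<r. f $ n = 0)"
proof (cases "f = 0")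
  case False
  have "r \<le> subdegree f \<longleftrightarrow> (\<forall>n<r. f $ n = 0)"
    using False by (metis nth_subdegree_nonzero nth_less_subdegree_zero le_less_trans not_le order.strict_trans2)
  then show ?thesis using False by (simp add: fps_dvd_iff)
qed simp

lemma fps_X_dvd_iff: "fps_X dvd (f :: 'a::field fps) \<longleftrightarrow> f $ 0 = 0"
  using fps_X_power_dvd_iff[of 1 f] by simp

lemma fps_eq_0_if_X_power_dvd:
  fixes f :: "'a::field fps"
  assumes "\<And>n. fps_X ^ n dvd f"
  shows "f = 0"
proof (rule fps_ext)
  show "f $ n = 0 $ n" for n
    using assms[of "Suc n"] by (simp add: fps_X_power_dvd_iff del: power_Suc)
qed

lemma fps_X_power_dvd_deriv:
  fixes f :: "'a::field fps"
  assumes "fps_X ^ r dvd f"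
  shows "fps_X ^ (r - 1) dvd fps_deriv f"
  using assms by (auto simp: fps_X_power_dvd_iff)

text \<open>The polynomial \<open>(G ^ j - X ^ j) / (G - X)\<close> in \<open>G\<close> and \<open>X\<close>.\<close>

definition power_diffquot :: "'a::field fps \<Rightarrow> nat \<Rightarrow> 'a fps" where
  "power_diffquot G j = (\<Sum>a<j. fps_X ^ (j - Suc a) * G ^ a)"

text \<open>This is \<open>(f oo G - f) / (G - X)\<close> summed termwise, which keeps integrality
  visible and also makes sense for \<open>G = X\<close>. Stopping at \<open>Suc n\<close> loses
  nothing if \<open>G $ 0 = 0\<close>, since the \<open>j\<close>-th quotient then has order at
  least \<open>j - 1\<close>.\<close>

definition fps_diffquot :: "'a::field fps \<Rightarrow> 'a fps \<Rightarrow> 'a fps" where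
  "fps_diffquot G f = Abs_fps (\<lambda>n. \<Sum>j\<le>Suc n. f $ j * power_diffquot G j $ n)"

definition fps_increment :: "'a::field fps \<Rightarrow> 'a fps \<Rightarrow> 'a fps" where
  "fps_increment G f = (f oo G) - f"

lemma power_diffquot_mult: "(G - fps_X) * power_diffquot G j = G ^ j - fps_X ^ j"
  by (simp add: power_diffquot_def power_diff_sumr2)

lemma power_diffquot_order:
  assumes "G $ 0 = 0"
  shows "fps_X ^ (j - 1) dvd power_diffquot G j"
  unfolding power_diffquot_def
proof (rule dvd_sum)
  fix a assume "a \<in> {..<j}"
  then have "fps_X ^ (j - 1) = (fps_X ^ (j - Suc a) * fps_X ^ a :: 'a fps)"
    by (simp flip: power_add)
  also have "\<dots> dvd fps_X ^ (j - Suc a) * G ^ a"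
    using assms by (intro mult_dvd_mono dvd_power_same dvd_refl) (simp add: fps_X_dvd_iff)
  finally show "fps_X ^ (j - 1) dvd fps_X ^ (j - Suc a) * G ^ a" .
qed

text \<open>For \<open>G = X\<close> all \<open>j\<close> summands equal \<open>X^(j-1)\<close>.
  Replacing \<open>X^a\<close> by \<open>G^a\<close> changes a summand by a multiple of
  \<open>G - X\<close>, of order at least \<open>j - 1 + i\<close>.\<close>

lemma power_diffquot_approx:
  fixes G :: "'a::field fps"
  assumes "G $ 0 = 0" "fps_X ^ Suc i dvd G - fps_X"
  shows "fps_X ^ (j - 1 + i) dvd power_diffquot G j - of_nat j * fps_X ^ (j - 1)"
proof -
  have "(\<Sum>a<j. fps_X ^ (j - Suc a) * fps_X ^ a) = (\<Sum>a<j. fps_X ^ (j - 1) :: 'a fps)"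
    by (intro sum.cong refl) (simp flip: power_add)
  then have "power_diffquot G j - of_nat j * fps_X ^ (j - 1)
        = (\<Sum>a<j. fps_X ^ (j - Suc a) * (G ^ a - fps_X ^ a))"
    by (simp add: power_diffquot_def right_diff_distrib sum_subtractf)
  moreover have "fps_X ^ (j - 1 + i) dvd fps_X ^ (j - Suc a) * (G ^ a - fps_X ^ a)" if "a < j" for a
  proof (cases "a = 0")
    case False
    have "fps_X ^ Suc i * fps_X ^ (a - 1) dvd G ^ a - fps_X ^ a"
      unfolding power_diffquot_mult[symmetric]
      by (intro mult_dvd_mono assms power_diffquot_order)
    then have "fps_X ^ (j - Suc a) * (fps_X ^ Suc i * fps_X ^ (a - 1))
       dvd fps_X ^ (j - Suc a) * (G ^ a - fps_X ^ a)"
      by (rule mult_dvd_mono[OF dvd_refl])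
    moreover have "j - Suc a + (Suc i + (a - 1)) = j - 1 + i" using that False by auto
    ultimately show ?thesis by (simp only: power_add[symmetric])
  qed simp
  ultimately show ?thesis by (auto intro: dvd_sum)
qed

lemma fps_diffquot_nth:
  assumes "G $ 0 = 0" "Suc n \<le> N"
  shows "fps_diffquot G f $ n = (\<Sum>j\<le>N. f $ j * power_diffquot G j $ n)"
  unfolding fps_diffquot_def fps_nth_Abs_fps
proof (rule sum.mono_neutral_left)
  have "power_diffquot G j $ n = 0" if "Suc n < j" for j
    using power_diffquot_order[OF assms(1), of j] that
    unfolding fps_X_power_dvd_iff by auto
  then show "\<forall>j\<in>{..N} - {..Suc n}. f $ j * power_diffquot G j $ n = 0" by auto
qed (use assms in auto)

lemma fps_increment_eq:
  assumes "G $ 0 = 0"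
  shows "fps_increment G f = (G - fps_X) * fps_diffquot G f"
proof (rule fps_ext)
  fix n
  have "((G - fps_X) * fps_diffquot G f) $ n
      = (\<Sum>m\<le>n. (G - fps_X) $ m * (\<Sum>j\<le>Suc n. f $ j * power_diffquot G j $ (n - m)))"
    unfolding fps_mult_nth atLeast0AtMost
    by (intro sum.cong refl arg_cong2[of _ _ _ _ "(*)"] fps_diffquot_nth assms) auto
  also have "\<dots> = (\<Sum>j\<le>Suc n. f $ j * (\<Sum>m\<le>n. (G - fps_X) $ m * power_diffquot G j $ (n - m)))"
    unfolding sum_distrib_left by (subst sum.swap) (simp add: mult_ac)
  also have "\<dots> = (\<Sum>j\<le>Suc n. f $ j * (G ^ j - fps_X ^ j) $ n)"
    unfolding power_diffquot_mult[symmetric] fps_mult_nth atLeast0AtMost ..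
  also have "\<dots> = (\<Sum>j\<le>n. f $ j * (G ^ j - fps_X ^ j) $ n)"
  proof -
    have "fps_X ^ Suc n dvd G ^ Suc n"
      using assms by (intro dvd_power_same) (simp add: fps_X_dvd_iff)
    then have "(G ^ Suc n - fps_X ^ Suc n) $ n = 0"
      unfolding fps_X_power_dvd_iff by (simp add: fps_X_power_nth del: power_Suc)
    then show ?thesis unfolding sum.atMost_Suc by simp
  qed
  also have "\<dots> = (f oo G) $ n - (f oo fps_X) $ n"
    by (simp only: fps_compose_nth atLeast0AtMost fps_sub_nth right_diff_distrib sum_subtractf)
  also have "\<dots> = fps_increment G f $ n"
    by (simp add: fps_increment_def)
  finally show "fps_increment G f $ n = ((G - fps_X) * fps_diffquot G f) $ n" ..
qed

lemma fps_diffquot_order: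
  assumes "G $ 0 = 0" "fps_X ^ r dvd f"
  shows "fps_X ^ (r - 1) dvd fps_diffquot G f"
  unfolding fps_X_power_dvd_iff
proof (intro allI impI)
  fix n assume n: "n < r - 1"
  have "f $ j * power_diffquot G j $ n = 0" for j
    using assms(2) power_diffquot_order[OF assms(1), of j] n
    by (cases "j < r") (auto simp: fps_X_power_dvd_iff)
  then show "fps_diffquot G f $ n = 0" by (simp only: fps_diffquot_def fps_nth_Abs_fps sum.neutral_const)
qed

lemma fps_diffquot_approx:
  fixes G f :: "'a::field fps"
  assumes "G $ 0 = 0" "fps_X ^ Suc i dvd G - fps_X" "fps_X ^ r dvd f"
  shows "fps_X ^ (r - 1 + i) dvd fps_diffquot G f - fps_deriv f"
  unfolding fps_X_power_dvd_iff
proof (intro allI impI)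
  fix n assume n: "n < r - 1 + i"
  have zero: "f $ j * (power_diffquot G j - of_nat j * fps_X ^ (j - 1)) $ n = 0" for j
    using assms(3) power_diffquot_approx[OF assms(1,2), of j] n
    by (cases "j < r") (auto simp: fps_X_power_dvd_iff)
  have "fps_deriv f $ n = (\<Sum>j\<le>Suc n. f $ j * (of_nat j * fps_X ^ (j - 1)) $ n)"
  proof -
    have "f $ j * (of_nat j * fps_X ^ (j - 1)) $ n = (if j = Suc n then of_nat j * f $ j else 0)" for j
      by (cases j) (auto simp: fps_X_power_nth simp flip: fps_of_nat)
    then show ?thesis by simp
  qed
  then show "(fps_diffquot G f - fps_deriv f) $ n = 0"
    using zero unfolding fps_sub_nth fps_diffquot_def fps_nth_Abs_fps
    by (simp only: right_diff_distrib sum_subtractf[symmetric] sum.neutral_const)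
qed

text \<open>\<open>G - X\<close> contributes order \<open>i + 1\<close>, and the difference quotient
  loses at most one.\<close>

lemma fps_increment_order:
  assumes "G $ 0 = 0" "fps_X ^ Suc i dvd G - fps_X" "fps_X ^ r dvd f"
  shows "fps_X ^ (r + i) dvd fps_increment G f"
proof -
  have "fps_X ^ Suc i * fps_X ^ (r - 1) dvd fps_increment G f"
    unfolding fps_increment_eq[OF assms(1)]
    by (intro mult_dvd_mono assms fps_diffquot_order)
  moreover have "r + i \<le> Suc i + (r - 1)" by auto
  ultimately show ?thesis unfolding power_add[symmetric] using power_le_dvd by blast
qed

lemma mult_deriv_order:
  fixes v f :: "'a::field fps"
  assumes "fps_X ^ Suc i dvd v" "fps_X ^ r dvd f"
  shows "fps_X ^ (r + i) dvd v * fps_deriv f"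
proof -
  have "fps_X ^ Suc i * fps_X ^ (r - 1) dvd v * fps_deriv f"
    by (intro mult_dvd_mono assms fps_X_power_dvd_deriv)
  moreover have "r + i \<le> Suc i + (r - 1)" by auto
  ultimately show ?thesis unfolding power_add[symmetric] using power_le_dvd by blast
qed

text \<open>Each of the two operators raises orders by \<open>i\<close>; their difference raises
  them by \<open>2 * i\<close>, because the difference quotient agrees with the derivative up to a
  further order \<open>i\<close>.\<close>

lemma fps_increment_approx:
  assumes "G $ 0 = 0" "fps_X ^ Suc i dvd G - fps_X" "fps_X ^ r dvd f"
  shows "fps_X ^ (r + 2 * i) dvd fps_increment G f - (G - fps_X) * fps_deriv f"
proof -
  have "fps_X ^ Suc i * fps_X ^ (r - 1 + i) dvd fps_increment G f - (G - fps_X) * fps_deriv f"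
    unfolding fps_increment_eq[OF assms(1)] right_diff_distrib[symmetric]
    by (intro mult_dvd_mono assms fps_diffquot_approx)
  moreover have "r + 2 * i \<le> Suc i + (r - 1 + i)" by auto
  ultimately show ?thesis unfolding power_add[symmetric] using power_le_dvd by blast
qed

section \<open>Iterates of additive operators and binomial expansions\<close>

lemma additive_fps_increment: "Modules.additive (fps_increment G)"
  by unfold_locales (simp add: fps_increment_def fps_compose_add_distrib)

lemma additive_mult_deriv: "Modules.additive (\<lambda>f. v * fps_deriv f)" for v :: "'a::field fps"
  by unfold_locales (simp add: algebra_simps)

lemma additive_funpow: "Modules.additive (d :: 'a::ab_group_add \<Rightarrow> 'a) \<Longrightarrow> Modules.additive (d ^^ m)"
  by (induction m) (auto simp: Modules.additive_def)

lemma funpow_order: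
  fixes A :: "'a::field fps \<Rightarrow> 'a fps"
  assumes "\<And>r f. fps_X ^ r dvd f \<Longrightarrow> fps_X ^ (r + i) dvd A f" "fps_X ^ r dvd f"
  shows "fps_X ^ (r + m * i) dvd (A ^^ m) f"
proof (induction m)
  case (Suc m)
  show ?case using assms(1)[OF Suc] by (simp add: add_ac)
qed (use assms in simp)

text \<open>
  Since \<open>A\<^sup>m\<^sup>+\<^sup>1 - B\<^sup>m\<^sup>+\<^sup>1 = A (A\<^sup>m - B\<^sup>m) + (A - B) B\<^sup>m\<close>, the error term gains \<open>i\<close> with each
  further iteration.
\<close>

lemma funpow_diff_order:
  fixes A B :: "'a::field fps \<Rightarrow> 'a fps"
  assumes "Modules.additive A"
    and A: "\<And>r f. fps_X ^ r dvd f \<Longrightarrow> fps_X ^ (r + i) dvd A f"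
    and B: "\<And>r f. fps_X ^ r dvd f \<Longrightarrow> fps_X ^ (r + i) dvd B f"
    and AB: "\<And>r f. fps_X ^ r dvd f \<Longrightarrow> fps_X ^ (r + j) dvd A f - B f"
    and f: "fps_X ^ r dvd f"
  shows "fps_X ^ (r + m * i + j) dvd (A ^^ Suc m) f - (B ^^ Suc m) f"
proof (induction m)
  case 0
  then show ?case using AB[OF f] by simp
next
  case (Suc m)
  have "(A ^^ Suc (Suc m)) f - (B ^^ Suc (Suc m)) f
     = A ((A ^^ Suc m) f - (B ^^ Suc m) f) + (A ((B ^^ Suc m) f) - B ((B ^^ Suc m) f))"
    using Modules.additive.diff[OF assms(1)] by simp
  moreover have "fps_X ^ (r + Suc m * i + j) dvd A ((A ^^ Suc m) f - (B ^^ Suc m) f)"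
    using A[OF Suc] by (simp add: add_ac)
  moreover have "fps_X ^ (r + Suc m * i + j) dvd A ((B ^^ Suc m) f) - B ((B ^^ Suc m) f)"
    by (rule AB[OF funpow_order[OF B f]])
  ultimately show ?case by (metis dvd_add)
qed

lemma sum_binomial_pascal:
  fixes a :: "nat \<Rightarrow> 'a::comm_semiring_1"
  shows "(\<Sum>j\<le>Suc m. of_nat (Suc m choose j) * a j)
    = (\<Sum>j\<le>m. of_nat (m choose j) * a j) + (\<Sum>j\<le>m. of_nat (m choose j) * a (Suc j))"
proof -
  have "(\<Sum>j\<le>Suc m. of_nat (Suc m choose j) * a j)
     = (a 0 + (\<Sum>j\<le>m. of_nat (m choose Suc j) * a (Suc j))) + (\<Sum>j\<le>m. of_nat (m choose j) * a (Suc j))"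
    by (simp add: sum.atMost_Suc_shift algebra_simps sum.distrib del: sum.atMost_Suc)
  also have "a 0 + (\<Sum>j\<le>m. of_nat (m choose Suc j) * a (Suc j)) = (\<Sum>j\<le>Suc m. of_nat (m choose j) * a j)"
    by (simp add: sum.atMost_Suc_shift del: sum.atMost_Suc)
  also have "(\<Sum>j\<le>Suc m. of_nat (m choose j) * a j) = (\<Sum>j\<le>m. of_nat (m choose j) * a j)"
    by (simp add: binomial_eq_0)
  finally show ?thesis .
qed

text \<open>The identity commutes with \<open>d\<close>, so the binomial theorem applies to additive
  operators.\<close>

lemma funpow_id_plus:
  fixes d :: "'a::comm_ring_1 \<Rightarrow> 'a"
  assumes "Modules.additive d"
  shows "((\<lambda>x. x + d x) ^^ m) x = (\<Sum>j\<le>m. of_nat (m choose j) * (d ^^ j) x)"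
proof (induction m arbitrary: x)
  case (Suc m)
  have "Modules.additive (\<lambda>x. x + d x)" using assms by (simp add: Modules.additive_def)
  from Modules.additive.add[OF additive_funpow[OF this]]
  have "((\<lambda>x. x + d x) ^^ Suc m) x = ((\<lambda>x. x + d x) ^^ m) x + ((\<lambda>x. x + d x) ^^ m) (d x)"
    unfolding funpow_Suc_right comp_apply .
  then show ?case
    unfolding Suc sum_binomial_pascal by (simp add: funpow_swap1)
qed simp

lemma funpow_derivation:
  fixes d :: "'a::comm_ring_1 \<Rightarrow> 'a"
  assumes "Modules.additive d" and leibniz: "\<And>x y. d (x * y) = d x * y + x * d y"
  shows "(d ^^ m) (x * y) = (\<Sum>j\<le>m. of_nat (m choose j) * ((d ^^ j) x * (d ^^ (m - j)) y))"
proof (induction m arbitrary: x y)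
  case (Suc m)
  have "(d ^^ Suc m) (x * y) = (d ^^ m) (d x * y) + (d ^^ m) (x * d y)"
    using Modules.additive.add[OF additive_funpow[OF assms(1)]] leibniz by (simp add: funpow_swap1)
  also have "(d ^^ m) (x * d y) = (\<Sum>j\<le>m. of_nat (m choose j) * ((d ^^ j) x * (d ^^ (Suc m - j)) y))"
    unfolding Suc
  proof (intro sum.cong refl)
    fix j assume "j \<in> {..m}"
    then have "Suc m - j = Suc (m - j)" by auto
    then show "of_nat (m choose j) * ((d ^^ j) x * (d ^^ (m - j)) (d y))
      = of_nat (m choose j) * ((d ^^ j) x * (d ^^ (Suc m - j)) y)" by (simp add: funpow_swap1)
  qed
  also have "(d ^^ m) (d x * y) = (\<Sum>j\<le>m. of_nat (m choose j) * ((d ^^ Suc j) x * (d ^^ (Suc m - Suc j)) y))"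
    unfolding Suc by (simp add: funpow_swap1)
  finally show ?case
    unfolding sum_binomial_pascal[where a = "\<lambda>j. (d ^^ j) x * (d ^^ (Suc m - j)) y"]
    by (simp only: add.commute)
qed simp

text \<open>The prime divides every inner binomial coefficient. Both the expansion of an iterate and
  the Leibniz expansion collapse through this.\<close>

lemma sum_binomial_CHAR:
  fixes a :: "nat \<Rightarrow> 'a::comm_ring_1"
  assumes "prime CHAR('a)"
  shows "(\<Sum>j\<le>CHAR('a). of_nat (CHAR('a) choose j) * a j) = a 0 + a CHAR('a)"
proof -
  let ?p = "CHAR('a)"
  have "?p > 0" using assms by (rule prime_gt_0_nat)
  have "of_nat (?p choose j) * a j = 0" if "j \<in> {..?p} - {0, ?p}" for j
  proof -
    have "?p dvd (?p choose j)" using that assms by (intro dvd_choose_prime) auto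
    then have "of_nat (?p choose j) = (0 :: 'a)" by (simp only: of_nat_eq_0_iff_char_dvd)
    then show ?thesis by simp
  qed
  then have "(\<Sum>j\<le>?p. of_nat (?p choose j) * a j) = (\<Sum>j\<in>{0, ?p}. of_nat (?p choose j) * a j)"
    by (intro sum.mono_neutral_right) auto
  then show ?thesis using \<open>?p > 0\<close> by simp
qed

section \<open>Compositional iterates and derivations\<close>

lemma fps_iterate_simps [simp]:
  "fps_iterate f 0 = fps_X" "fps_iterate f (Suc n) = f oo fps_iterate f n"
  by (simp_all add: fps_iterate_def)

lemma fps_iterate_nth_0 [simp]: "f $ 0 = 0 \<Longrightarrow> fps_iterate f n $ 0 = 0"
  by (induction n) auto

lemma fps_iterate_add:
  assumes "f $ 0 = 0"
  shows "fps_iterate f (m + n) = fps_iterate f m oo fps_iterate f n"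
  using assms by (induction m) (simp_all add: fps_compose_assoc)

lemma fps_iterate_mult:
  assumes "f $ 0 = 0"
  shows "fps_iterate f (m * n) = fps_iterate (fps_iterate f m) n"
  using assms by (induction n) (simp_all add: fps_iterate_add)

text \<open>Right composition with \<open>G\<close> is the additive operator
  \<open>id + \<delta>\<close>, and the iterate is a power of this operator applied to
  \<open>X\<close>.\<close>

lemma fps_iterate_conv_increment:
  assumes "G $ 0 = 0"
  shows "fps_iterate G m = (\<Sum>j\<le>m. of_nat (m choose j) * (fps_increment G ^^ j) fps_X)"
proof -
  have "fps_iterate G m = ((\<lambda>f. f oo G) ^^ m) fps_X"
  proof (induction m)
    case (Suc m)
    have "fps_iterate G (m + 1) = fps_iterate G m oo G"
      unfolding fps_iterate_add[OF assms] by simp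
    then show ?case using Suc by simp
  qed simp
  also have "(\<lambda>f. f oo G) = (\<lambda>f. f + fps_increment G f)"
    by (simp add: fps_increment_def)
  finally show ?thesis by (simp add: funpow_id_plus[OF additive_fps_increment])
qed

lemma fps_iterate_CHAR:
  fixes G :: "'a::field fps"
  assumes "CHAR('a) > 0" "G $ 0 = 0"
  shows "fps_iterate G CHAR('a) - fps_X = (fps_increment G ^^ CHAR('a)) fps_X"
  using sum_binomial_CHAR[where 'a = "'a fps", of "\<lambda>j. (fps_increment G ^^ j) fps_X"]
    assms prime_CHAR_semidom[where 'a = 'a] by (simp add: fps_iterate_conv_increment)

text \<open>Writing \<open>f = f(0) + X * h\<close> gives \<open>d f = X * d h\<close>; repeating
  this, every power of \<open>X\<close> divides \<open>d f\<close>.\<close>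

lemma fps_derivation_eq_0:
  fixes d :: "'a::field fps \<Rightarrow> 'a fps"
  assumes "Modules.additive d" and leibniz: "\<And>f g. d (f * g) = d f * g + f * d g"
    and "\<And>c. d (fps_const c) = 0" "d fps_X = 0"
  shows "d f = 0"
proof (rule fps_eq_0_if_X_power_dvd)
  show "fps_X ^ n dvd d f" for n
  proof (induction n arbitrary: f)
    case (Suc n)
    have "f = fps_const (f $ 0) + fps_X * fps_shift 1 f"
      by (rule fps_ext) (auto simp: )
    then have "d f = d (fps_const (f $ 0)) + d (fps_X * fps_shift 1 f)"
      using Modules.additive.add[OF assms(1)] by metis
    also have "\<dots> = fps_X * d (fps_shift 1 f)"
      by (simp add: assms)
    finally show ?case using Suc by simp
  qed simp
qed

lemma funpow_const_mult_deriv: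
  fixes lam v f :: "'a::field fps"
  assumes "fps_deriv lam = 0"
  shows "((\<lambda>f. lam * v * fps_deriv f) ^^ m) f = lam ^ m * ((\<lambda>f. v * fps_deriv f) ^^ m) f"
proof (induction m)
  case (Suc m)
  have "fps_deriv (lam ^ m) = 0" by (simp add: fps_deriv_power assms)
  then show ?case using Suc by (simp add: mult_ac)
qed simp

text \<open>
  In characteristic \<open>p\<close> the \<open>p\<close>-th power of the vector field \<open>v \<partial>\<close> is again a derivation, hence of
  the form \<open>lam v \<partial>\<close>; as it commutes with \<open>v \<partial>\<close>, the factor \<open>lam\<close> is a constant of \<open>\<partial>\<close>.
\<close>

lemma funpow_CHAR_mult_deriv:
  fixes v :: "'a::field fps"
  assumes "CHAR('a) > 0" "v \<noteq> 0"
  obtains lam where "fps_deriv lam = 0" "((\<lambda>f. v * fps_deriv f) ^^ CHAR('a)) fps_X = lam * v"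
proof -
  define p where "p = CHAR('a)"
  define d where "d = (\<lambda>f. v * fps_deriv f)"
  have d: "d f = v * fps_deriv f" for f by (simp add: d_def)
  have p: "prime p" unfolding p_def using assms(1) by (rule prime_CHAR_semidom)
  then obtain m where m: "p = Suc m" using prime_gt_0_nat gr0_implies_Suc by blast
  have add: "Modules.additive (d ^^ n)" for n
    unfolding d_def by (intro additive_funpow additive_mult_deriv)
  have add': "(d ^^ n) (f + g) = (d ^^ n) f + (d ^^ n) g" for n f g
    by (rule Modules.additive.add[OF add])
  have leibniz: "d (f * g) = d f * g + f * d g" for f g
    by (simp add: d algebra_simps)
  have leibniz_p: "(d ^^ p) (f * g) = (d ^^ p) f * g + f * (d ^^ p) g" for f g
    using funpow_derivation[OF add[of 1, simplified] leibniz, of p f g]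
      sum_binomial_CHAR[where 'a = "'a fps", of "\<lambda>j. (d ^^ j) f * (d ^^ (p - j)) g"] p
    by (simp add: p_def add.commute)
  \<comment> \<open>The factor is forced by the value of the derivation at \<open>X\<close>; the
    outermost \<open>d\<close> makes that value a multiple of \<open>v\<close>.\<close>
  define lam where "lam = fps_deriv ((d ^^ m) fps_X)"
  have lam: "(d ^^ p) fps_X = lam * v"
    by (simp add: m lam_def d)
  have const: "(d ^^ p) (fps_const c) = 0" for c
  proof -
    have "d (fps_const c) = 0" by (simp add: d)
    then show ?thesis
      unfolding m funpow_Suc_right comp_apply by (simp add: Modules.additive.zero[OF add])
  qed
  have "(d ^^ p) f - lam * v * fps_deriv f = 0" for f
  proof (rule fps_derivation_eq_0[where d = "\<lambda>f. (d ^^ p) f - lam * v * fps_deriv f"])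
    show "Modules.additive (\<lambda>f. (d ^^ p) f - lam * v * fps_deriv f)"
      by unfold_locales (simp add: add' algebra_simps)
    show "(d ^^ p) (f * g) - lam * v * fps_deriv (f * g)
      = ((d ^^ p) f - lam * v * fps_deriv f) * g + f * ((d ^^ p) g - lam * v * fps_deriv g)" for f g
      by (simp add: leibniz_p algebra_simps)
  qed (simp_all add: const lam)
  \<comment> \<open>Computing \<open>d^(p+1) X\<close> in two ways gives
    \<open>v^2 * fps_deriv lam = 0\<close>.\<close>
  then have "lam * v * fps_deriv v = (d ^^ p) v" by simp
  also have "\<dots> = (d ^^ p) (d fps_X)" by (simp add: d)
  also have "\<dots> = d ((d ^^ p) fps_X)" by (simp add: funpow_swap1)
  also have "\<dots> = v * (fps_deriv lam * v + lam * fps_deriv v)"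
    unfolding lam d by (simp add: add.commute)
  finally have "v * (v * fps_deriv lam) = 0" by (simp add: algebra_simps)
  then have "fps_deriv lam = 0" using assms(2) by simp
  then show thesis using that lam unfolding d_def p_def by blast
qed

text \<open>The numbers \<open>i\<close>, \<open>p * i + q\<close> and
  \<open>p * (p * i + q) + q\<close> play the role of consecutive ramification numbers. Some
  \<open>lam\<close> satisfies \<open>v1 = lam * v0\<close> and \<open>v2 = lam^(p+1) * v0\<close>
  up to higher terms, so the two ratios are the leading coefficient of \<open>lam\<close> and its
  \<open>p\<close>-th power.\<close>

lemma lead_coeff_iterates_CHAR:
  fixes v0 v1 v2 :: "'a::field fps"
  defines "p \<equiv> CHAR('a)"
  assumes p0: "CHAR('a) > 0" and G: "G $ 0 = 0" and q: "0 < q" "2 * q < i"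
    and v0: "v0 = G - fps_X" "subdegree v0 = Suc i"
    and v1: "v1 = fps_iterate G p - fps_X" "subdegree v1 = Suc (p * i + q)"
    and v2: "v2 = fps_iterate (fps_iterate G p) p - fps_X" "subdegree v2 = Suc (p * (p * i + q) + q)"
  shows "(v2 $ subdegree v2) / (v1 $ subdegree v1) = ((v1 $ subdegree v1) / (v0 $ subdegree v0)) ^ p"
proof -
  define H where "H = fps_iterate G p"
  define I where "I = p * i + q"
  have H0: "H $ 0 = 0" using G by (simp add: H_def)
  have nz: "v0 \<noteq> 0" "v1 \<noteq> 0" "v2 \<noteq> 0" using v0(2) v1(2) v2(2) by auto
  have p: "prime p" unfolding p_def using p0 by (rule prime_CHAR_semidom)
  then obtain m where m: "p = Suc m" using prime_gt_0_nat gr0_implies_Suc by blast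
  have ord0: "fps_X ^ Suc i dvd G - fps_X" using nz v0 by (simp add: fps_dvd_iff)
  have ord1: "fps_X ^ Suc I dvd H - fps_X" using nz v1 by (simp add: fps_dvd_iff H_def I_def)
  have X: "fps_X ^ 1 dvd (fps_X :: 'a fps)" by simp
  obtain lam where lam: "fps_deriv lam = 0"
    "((\<lambda>f. v0 * fps_deriv f) ^^ p) fps_X = lam * v0"
    using funpow_CHAR_mult_deriv[OF p0 nz(1)] unfolding p_def by blast
  have v1_eq: "v1 = (fps_increment G ^^ p) fps_X"
    unfolding v1 p_def using p0 G by (rule fps_iterate_CHAR)
  have v2_eq: "v2 = (fps_increment H ^^ p) fps_X"
    using fps_iterate_CHAR[OF p0 H0] by (simp add: v2 H_def p_def)

  \<comment> \<open>The exponent consists of order 1 for \<open>X\<close>, a gain of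
    \<open>i\<close> for each of \<open>m = p - 1\<close> further iterations, and the discrepancy
    \<open>2 * i\<close> of one step.\<close>
  have "fps_X ^ (1 + m * i + 2 * i) dvd (fps_increment G ^^ Suc m) fps_X
      - ((\<lambda>f. v0 * fps_deriv f) ^^ Suc m) fps_X"
    unfolding v0(1)
    by (rule funpow_diff_order[OF additive_fps_increment _ _ _ X];
        intro fps_increment_order fps_increment_approx mult_deriv_order G ord0)
  then have err1: "fps_X ^ Suc ((p + 1) * i) dvd v1 - lam * v0"
    unfolding m[symmetric] v1_eq[symmetric] lam by (simp add: m add_ac mult_ac numeral_2_eq_2)
  have "I < (p + 1) * i" using q by (simp add: I_def)
  then have "(v1 - lam * v0) $ Suc I = 0" "fps_X ^ Suc I dvd v1 - lam * v0"
    using err1 unfolding fps_X_power_dvd_iff by simp_all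
  then have lead1: "(lam * v0) $ Suc I = v1 $ Suc I" and ord: "fps_X ^ Suc I dvd lam * v0"
    using nz(2) v1(2) by (auto simp: I_def fps_dvd_iff dvd_diff_right_iff)
  have lead1_nz: "v1 $ Suc I \<noteq> 0" using nz(2) v1(2) unfolding I_def by (metis nth_subdegree_nonzero)
  have lamv_nz: "lam * v0 \<noteq> 0" using lead1 lead1_nz by auto
  have sub_lamv: "subdegree (lam * v0) = Suc I"
    by (rule subdegreeI) (use lead1 lead1_nz ord[unfolded fps_X_power_dvd_iff] in auto)
  have lam_nz: "lam \<noteq> 0" using lamv_nz by auto
  define e where "e = subdegree lam"
  have e: "e + i = I" using sub_lamv lam_nz nz(1) v0(2) by (simp add: e_def)
  have lead_lam: "lam $ e * v0 $ Suc i = v1 $ Suc I"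
    using lead1 sub_lamv v0(2) nth_subdegree_mult[of lam v0] e
    by (simp add: e_def)

  have err1': "fps_X ^ Suc ((p + 1) * i) dvd (H - fps_X) - lam * v0"
    using err1 v1 H_def by simp
  \<comment> \<open>Two errors combine: linearizing the increment of \<open>H\<close> leaves order
    \<open>r + 2 * I\<close>, and replacing \<open>H - X\<close> by \<open>lam * v0\<close> leaves
    the weaker \<open>r + (p + 1) * i\<close>.\<close>
  have near: "fps_X ^ (r + (p + 1) * i) dvd fps_increment H f - lam * v0 * fps_deriv f"
    if f: "fps_X ^ r dvd f" for r f
  proof -
    have "fps_X ^ (r + 2 * I) dvd fps_increment H f - (H - fps_X) * fps_deriv f"
      by (rule fps_increment_approx[OF H0 ord1 f])
    moreover have "(p + 1) * i \<le> 2 * I"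
    proof -
      have "(p + 1) * i \<le> (2 * p) * i" using m by (intro mult_le_mono1) simp
      then show ?thesis unfolding I_def by (simp only: distrib_left mult.assoc trans_le_add1)
    qed
    ultimately have "fps_X ^ (r + (p + 1) * i) dvd fps_increment H f - (H - fps_X) * fps_deriv f"
      by (rule power_le_dvd[OF _ add_left_mono])
    moreover have "fps_X ^ (r + (p + 1) * i) dvd ((H - fps_X) - lam * v0) * fps_deriv f"
      by (rule mult_deriv_order[OF err1' f])
    ultimately have "fps_X ^ (r + (p + 1) * i) dvd
       (fps_increment H f - (H - fps_X) * fps_deriv f) + ((H - fps_X) - lam * v0) * fps_deriv f"
      by (rule dvd_add)
    then show ?thesis by (simp add: algebra_simps)
  qed
  have "fps_X ^ (1 + m * I + (p + 1) * i) dvd (fps_increment H ^^ Suc m) fps_X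
      - ((\<lambda>f. lam * v0 * fps_deriv f) ^^ Suc m) fps_X"
    by (rule funpow_diff_order[OF additive_fps_increment _ _ _ X];
        intro fps_increment_order near mult_deriv_order H0 ord1 ord)
  then have err2: "fps_X ^ (1 + m * I + (p + 1) * i) dvd v2 - lam ^ p * (lam * v0)"
    unfolding m[symmetric] funpow_const_mult_deriv[OF lam(1)] lam v2_eq[symmetric] .
  \<comment> \<open>After cancellation this is exactly \<open>2 * q < i\<close>.\<close>
  have "p * I + q < m * I + (p + 1) * i" using q by (simp add: m I_def algebra_simps)
  then have "(v2 - lam ^ p * (lam * v0)) $ Suc (p * I + q) = 0"
    using err2 unfolding fps_X_power_dvd_iff by simp
  then have "v2 $ Suc (p * I + q) = (lam ^ p * (lam * v0)) $ Suc (p * I + q)"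
    by simp
  \<comment> \<open>\<open>lam\<close> has order \<open>e = I - i\<close>, so the product has order
    \<open>p * e + I + 1 = p * I + q + 1\<close>.\<close>
  also have "\<dots> = (lam ^ p * (lam * v0)) $ (subdegree (lam ^ p) + subdegree (lam * v0))"
  proof -
    have "p * I = p * e + p * i" unfolding e[symmetric] by (rule distrib_left)
    then show ?thesis by (simp add: sub_lamv subdegree_power e_def I_def add.assoc)
  qed
  also have "\<dots> = (lam ^ p) $ subdegree (lam ^ p) * (lam * v0) $ subdegree (lam * v0)"
    by (rule nth_subdegree_mult)
  also have "\<dots> = (lam $ e) ^ p * v1 $ Suc I"
    by (simp only: subdegree_power fps_pow_base sub_lamv lead1 e_def)
  finally have "v2 $ Suc (p * I + q) / v1 $ Suc I = (lam $ e) ^ p"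
    using lead1_nz by simp
  moreover have "lam $ e = v1 $ Suc I / v0 $ Suc i"
    using lead_lam lead1_nz by (metis mult_zero_right nonzero_mult_div_cancel_right)
  ultimately show ?thesis
    using v0(2) v1(2) v2(2) by (simp add: I_def)
qed

section \<open>Evaluation of integral power series\<close>

lemma absv_0 [simp]: "absv (0 :: 'a::ultrametric_field) = 0"
  by (simp add: absv_eq_0_iff)

lemma absv_1 [simp]: "absv (1 :: 'a::ultrametric_field) = 1"
  using absv_mult[of 1 "1 :: 'a"] absv_eq_0_iff[of "1 :: 'a"] by simp

lemma absv_minus [simp]: "absv (- x) = absv (x :: 'a::ultrametric_field)"
proof -
  have "absv (- 1 :: 'a) ^ 2 = 1"
    using absv_mult[of "- 1 :: 'a" "- 1"] by (simp add: power2_eq_square)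
  then have "absv (- 1 :: 'a) = 1"
    using absv_nonneg[of "- 1 :: 'a"] by (simp add: power2_eq_1_iff)
  then show ?thesis using absv_mult[of "- 1" x] by simp
qed

lemma absv_pos_iff: "0 < absv x \<longleftrightarrow> x \<noteq> 0"
  using absv_nonneg[of x] absv_eq_0_iff[of x] by linarith

lemma absv_power: "absv (x ^ n) = absv (x :: 'a::ultrametric_field) ^ n"
  by (induction n) (simp_all add: absv_mult)

lemma absv_add_le:
  fixes x :: "'a::ultrametric_field"
  shows "absv x \<le> B \<Longrightarrow> absv y \<le> B \<Longrightarrow> absv (x + y) \<le> B"
  using absv_add_le_max[of x y] by linarith

lemma absv_diff_le:
  fixes x :: "'a::ultrametric_field"
  shows "absv x \<le> B \<Longrightarrow> absv y \<le> B \<Longrightarrow> absv (x - y) \<le> B"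
  using absv_add_le[of x B "- y"] by simp

lemma absv_sum_le:
  fixes f :: "'b \<Rightarrow> 'a::ultrametric_field"
  assumes "\<And>i. i \<in> A \<Longrightarrow> absv (f i) \<le> B" "0 \<le> B"
  shows "absv (sum f A) \<le> B"
  using assms by (induction A rule: infinite_finite_induct) (auto intro: absv_add_le)

lemma absv_eqI:
  fixes x y :: "'a::ultrametric_field"
  assumes "\<And>n. absv (x - y) \<le> r ^ n" "0 \<le> r" "r < 1"
  shows "x = y"
proof -
  have "absv (x - y) \<le> 0"
    using LIMSEQ_realpow_zero[OF assms(2,3)] assms(1) by (intro LIMSEQ_le_const) auto
  then show ?thesis using absv_pos_iff[of "x - y"] by auto
qed

text \<open>By Bezout \<open>m\<close> has an inverse modulo the characteristic. Both images in the
  field have absolute value at most 1, and their product is 1.\<close>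

lemma absv_of_nat_eq_1:
  assumes "CHAR('a::ultrametric_field) > 0" "\<not> CHAR('a) dvd m"
  shows "absv (of_nat m :: 'a) = 1"
proof -
  have le: "absv (of_nat n :: 'a) \<le> 1" for n
    by (induction n) (auto intro: absv_add_le)
  have "prime CHAR('a)" using assms(1) by (rule prime_CHAR_semidom)
  then have "gcd m CHAR('a) = 1"
    using assms(2) by (metis coprime_iff_gcd_eq_1 coprime_commute prime_imp_coprime)
  moreover have "m \<noteq> 0" using assms(2) by (metis dvd_0_right)
  ultimately obtain x y where "m * x = CHAR('a) * y + 1" using bezout_nat[of m "CHAR('a)"] by auto
  then have "of_nat (m * x) = (of_nat (CHAR('a) * y + 1) :: 'a)" by (simp only:)
  then have "of_nat m * of_nat x = (1 :: 'a)" by simp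
  then have "absv (of_nat m :: 'a) * absv (of_nat x :: 'a) = 1" by (simp flip: absv_mult)
  then show ?thesis
    using le[of m] le[of x] absv_nonneg[of "of_nat m :: 'a"] absv_nonneg[of "of_nat x :: 'a"]
      mult_left_le[of "absv (of_nat x :: 'a)" "absv (of_nat m :: 'a)"] by linarith
qed

section \<open>Power series with integral coefficients\<close>

definition integral_fps :: "'a::ultrametric_field fps \<Rightarrow> bool" where
  "integral_fps f \<longleftrightarrow> (\<forall>n. absv (f $ n) \<le> 1)"

lemma integral_fpsD: "integral_fps f \<Longrightarrow> absv (f $ n) \<le> 1"
  by (simp add: integral_fps_def)

lemma integral_fps_simps [simp]: "integral_fps 0" "integral_fps 1" "integral_fps fps_X"
  by (simp_all add: integral_fps_def fps_X_def)

lemma integral_fps_const: "absv c \<le> 1 \<Longrightarrow> integral_fps (fps_const c)"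
  by (simp add: integral_fps_def)

lemma integral_fps_add: "integral_fps f \<Longrightarrow> integral_fps g \<Longrightarrow> integral_fps (f + g)"
  by (simp add: integral_fps_def absv_add_le)

lemma integral_fps_diff: "integral_fps f \<Longrightarrow> integral_fps g \<Longrightarrow> integral_fps (f - g)"
  by (simp add: integral_fps_def absv_diff_le)

lemma integral_fps_mult: "integral_fps f \<Longrightarrow> integral_fps g \<Longrightarrow> integral_fps (f * g)"
  unfolding integral_fps_def fps_mult_nth
  by (auto intro!: absv_sum_le mult_le_one simp: absv_mult absv_nonneg)

lemma integral_fps_sum: "(\<And>i. i \<in> A \<Longrightarrow> integral_fps (f i)) \<Longrightarrow> integral_fps (sum f A)"
  by (induction A rule: infinite_finite_induct) (auto intro: integral_fps_add)

lemma integral_fps_of_nat: "integral_fps (of_nat n)"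
  by (induction n) (auto intro: integral_fps_add)

lemma integral_fps_power: "integral_fps f \<Longrightarrow> integral_fps (f ^ n)"
  by (induction n) (auto intro: integral_fps_mult)

lemma integral_fps_shift: "integral_fps f \<Longrightarrow> integral_fps (fps_shift n f)"
  by (simp add: integral_fps_def)

lemma integral_fps_compose:
  assumes "integral_fps f" "integral_fps g"
  shows "integral_fps (f oo g)"
  using assms integral_fps_power[OF assms(2)] unfolding integral_fps_def fps_compose_nth
  by (auto intro!: absv_sum_le mult_le_one simp: absv_mult absv_nonneg)

lemma integral_fps_iterate: "integral_fps f \<Longrightarrow> integral_fps (fps_iterate f n)"
  by (induction n) (auto intro: integral_fps_compose)

lemma integral_fps_diffquot:
  assumes "integral_fps f" "integral_fps g"
  shows "integral_fps (fps_diffquot g f)"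
proof -
  have "integral_fps (power_diffquot g j)" for j
    unfolding power_diffquot_def
    by (intro integral_fps_sum integral_fps_mult integral_fps_power assms) simp
  then show ?thesis
    using assms(1) unfolding integral_fps_def fps_diffquot_def fps_nth_Abs_fps
    by (intro allI absv_sum_le) (auto intro!: mult_le_one simp: absv_mult absv_nonneg)
qed

lemma integral_fps_funpow_increment:
  assumes "integral_fps f" "integral_fps g"
  shows "integral_fps ((fps_increment g ^^ m) f)"
  using assms
  by (induction m) (auto simp: fps_increment_def intro: integral_fps_diff integral_fps_compose)

section \<open>Evaluation on the open unit disc\<close>

definition fps_eval :: "'a::{ultrametric_field, complete_space} fps \<Rightarrow> 'a \<Rightarrow> 'a" where
  "fps_eval f w = (\<Sum>n. f $ n * w ^ n)"

text \<open>Terms from index \<open>N\<close> on, and hence their finite sums, have absolute value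
  at most \<open>absv w ^ N\<close>. This yields both convergence and the error bound.\<close>

lemma fps_eval_approx:
  fixes f :: "'a::{ultrametric_field, complete_space} fps"
  assumes f: "integral_fps f" and w: "absv w < 1"
  shows "absv (fps_eval f w - (\<Sum>n<N. f $ n * w ^ n)) \<le> absv w ^ N"
proof -
  define s where "s = (\<lambda>N. \<Sum>n<N. f $ n * w ^ n)"
  have tail: "absv (s m - s N) \<le> absv w ^ N" if "N \<le> m" for m N
  proof -
    have "s m - s N = (\<Sum>n=N..<m. f $ n * w ^ n)"
      unfolding s_def lessThan_atLeast0 using that by (intro sum_diff_nat_ivl) auto
    moreover have "absv (f $ n * w ^ n) \<le> absv w ^ N" if "n \<in> {N..<m}" for n
    proof -
      have "absv (f $ n * w ^ n) \<le> 1 * absv w ^ n"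
        unfolding absv_mult absv_power
        by (intro mult_right_mono integral_fpsD f zero_le_power absv_nonneg)
      also have "\<dots> \<le> absv w ^ N" using that w by (simp add: absv_nonneg power_decreasing)
      finally show ?thesis .
    qed
    then have "absv (\<Sum>n=N..<m. f $ n * w ^ n) \<le> absv w ^ N"
      by (rule absv_sum_le) (simp_all add: absv_nonneg)
    ultimately show ?thesis by (simp only:)
  qed
  have "Cauchy s"
    unfolding Cauchy_altdef2
  proof (intro allI impI)
    fix e :: real assume "0 < e"
    then obtain N where "absv w ^ N < e" using w real_arch_pow_inv by blast
    then show "\<exists>N. \<forall>n\<ge>N. dist (s n) (s N) < e"
      using tail by (intro exI[of _ N]) (force simp: dist_absv)
  qed
  then have lim: "s \<longlonglongrightarrow> fps_eval f w"
    unfolding fps_eval_def suminf_eq_lim s_def[symmetric]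
    by (simp add: Cauchy_convergent flip: convergent_LIMSEQ_iff)
  have "absv (fps_eval f w - s N) \<le> absv w ^ N"
  proof (rule field_le_epsilon)
    fix e :: real assume "0 < e"
    then obtain M where "\<forall>m\<ge>M. dist (s m) (fps_eval f w) < e"
      using lim unfolding lim_sequentially by blast
    then have "dist (fps_eval f w) (s (max M N)) < e" by (metis dist_commute max.cobounded1)
    moreover have "0 \<le> absv w ^ N" by (intro zero_le_power absv_nonneg)
    ultimately have "absv (fps_eval f w - s (max M N)) \<le> absv w ^ N + e"
      unfolding dist_absv by linarith
    moreover have "absv (s (max M N) - s N) \<le> absv w ^ N + e"
      using tail[of N "max M N"] \<open>0 < e\<close> by simp
    ultimately have "absv ((fps_eval f w - s (max M N)) + (s (max M N) - s N)) \<le> absv w ^ N + e"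
      using absv_add_le by blast
    then show "absv (fps_eval f w - s N) \<le> absv w ^ N + e" by simp
  qed
  then show ?thesis by (simp add: s_def)
qed

lemma absv_fps_eval_le_1:
  "integral_fps f \<Longrightarrow> absv w < 1 \<Longrightarrow> absv (fps_eval f w) \<le> 1"
  using fps_eval_approx[of f w 0] by simp

text \<open>Multiplication by \<open>w\<close> shifts the partial sums by one index. This Horner
  step drives the inductions for products and compositions.\<close>

lemma fps_eval_unfold:
  fixes f :: "'a::{ultrametric_field, complete_space} fps"
  assumes f: "integral_fps f" and w: "absv w < 1"
  shows "fps_eval f w = f $ 0 + w * fps_eval (fps_shift 1 f) w"
proof (rule absv_eqI)
  fix N
  have "absv (fps_eval f w - (\<Sum>n<Suc N. f $ n * w ^ n)) \<le> absv w ^ N"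
    using fps_eval_approx[OF assms, of "Suc N"] w power_decreasing[of N "Suc N" "absv w"]
    by (simp add: absv_nonneg del: power_Suc sum.lessThan_Suc)
  moreover have "absv (w * (fps_eval (fps_shift 1 f) w - (\<Sum>n<N. f $ Suc n * w ^ n))) \<le> absv w ^ N"
  proof -
    have "absv w * absv (fps_eval (fps_shift 1 f) w - (\<Sum>n<N. f $ Suc n * w ^ n)) \<le> 1 * absv w ^ N"
      using fps_eval_approx[OF integral_fps_shift[OF f, of 1] w, of N] w
      by (intro mult_mono) (simp_all add: absv_nonneg)
    then show ?thesis by (simp add: absv_mult)
  qed
  ultimately have "absv ((fps_eval f w - (\<Sum>n<Suc N. f $ n * w ^ n))
     - w * (fps_eval (fps_shift 1 f) w - (\<Sum>n<N. f $ Suc n * w ^ n))) \<le> absv w ^ N"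
    by (rule absv_diff_le)
  then show "absv (fps_eval f w - (f $ 0 + w * fps_eval (fps_shift 1 f) w)) \<le> absv w ^ N"
    unfolding sum.lessThan_Suc_shift by (simp add: algebra_simps sum_distrib_left)
qed (use w in \<open>simp_all add: absv_nonneg\<close>)

lemma fps_eval_0 [simp]: "absv w < 1 \<Longrightarrow> fps_eval 0 w = 0"
proof (rule absv_eqI)
  show "absv w < 1 \<Longrightarrow> absv (fps_eval 0 w - 0) \<le> absv w ^ n" for n
    using fps_eval_approx[of 0 w n] by simp
qed (simp_all add: absv_nonneg)

lemma fps_eval_const: "absv c \<le> 1 \<Longrightarrow> absv w < 1 \<Longrightarrow> fps_eval (fps_const c) w = c"
proof -
  assume "absv c \<le> 1" "absv w < 1"
  moreover have "fps_shift 1 (fps_const c) = 0" by (rule fps_ext) simp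
  ultimately show ?thesis using fps_eval_unfold[of "fps_const c" w] by (simp add: integral_fps_const)
qed

lemma fps_eval_X [simp]: "absv w < 1 \<Longrightarrow> fps_eval fps_X w = w"
proof -
  assume w: "absv w < 1"
  have "fps_shift 1 fps_X = (fps_const 1 :: 'a fps)" by (rule fps_ext) (simp add: fps_X_def)
  then show ?thesis using fps_eval_unfold[of fps_X w] fps_eval_const[of 1 w] w by simp
qed

lemma fps_eval_add:
  assumes "integral_fps f" "integral_fps g" "absv w < 1"
  shows "fps_eval (f + g) w = fps_eval f w + fps_eval g w"
proof (rule absv_eqI)
  fix N
  let ?s = "\<lambda>f. \<Sum>n<N. f $ n * w ^ n"
  have "absv ((fps_eval (f + g) w - ?s (f + g)) - ((fps_eval f w - ?s f) + (fps_eval g w - ?s g)))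
     \<le> absv w ^ N"
    by (intro absv_diff_le absv_add_le fps_eval_approx integral_fps_add assms)
  then show "absv (fps_eval (f + g) w - (fps_eval f w + fps_eval g w)) \<le> absv w ^ N"
    by (simp add: algebra_simps sum.distrib)
qed (use assms in \<open>simp_all add: absv_nonneg\<close>)

lemma fps_eval_const_mult:
  assumes "absv c \<le> 1" "integral_fps f" "absv w < 1"
  shows "fps_eval (fps_const c * f) w = c * fps_eval f w"
proof (rule absv_eqI)
  fix N
  let ?s = "\<lambda>f. \<Sum>n<N. f $ n * w ^ n"
  have "absv c * absv (fps_eval f w - ?s f) \<le> 1 * absv w ^ N"
    by (intro mult_mono fps_eval_approx assms) (simp_all add: absv_nonneg)
  then have "absv (c * (fps_eval f w - ?s f)) \<le> absv w ^ N" by (simp add: absv_mult)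
  then have "absv ((fps_eval (fps_const c * f) w - ?s (fps_const c * f)) - c * (fps_eval f w - ?s f))
     \<le> absv w ^ N"
    by (intro absv_diff_le fps_eval_approx integral_fps_mult integral_fps_const assms)
  then show "absv (fps_eval (fps_const c * f) w - c * fps_eval f w) \<le> absv w ^ N"
    by (simp add: algebra_simps sum_distrib_left)
qed (use assms in \<open>simp_all add: absv_nonneg\<close>)

lemma fps_eval_diff:
  assumes "integral_fps f" "integral_fps g" "absv w < 1"
  shows "fps_eval (f - g) w = fps_eval f w - fps_eval g w"
  using fps_eval_add[OF integral_fps_diff[OF assms(1,2)] assms(2,3)] by simp

lemma fps_eval_X_mult:
  assumes "integral_fps f" "absv w < 1"
  shows "fps_eval (fps_X * f) w = w * fps_eval f w"
proof -
  have "fps_shift 1 (fps_X * f) = f" by (rule fps_ext) simp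
  then show ?thesis using fps_eval_unfold[of "fps_X * f" w] assms by (simp add: integral_fps_mult)
qed

lemma fps_decompose: "f = fps_const (f $ 0) + fps_X * fps_shift 1 (f :: 'a::comm_ring_1 fps)"
  by (rule fps_ext) simp

text \<open>Induction on the precision: splitting off the constant term of \<open>f\<close> turns
  the defect into \<open>w\<close> times the defect for the shifted series, so each step gains a
  factor \<open>absv w\<close>.\<close>

lemma fps_eval_mult:
  fixes f g :: "'a::{ultrametric_field, complete_space} fps"
  assumes "integral_fps f" "integral_fps g" "absv w < 1"
  shows "fps_eval (f * g) w = fps_eval f w * fps_eval g w"
proof (rule absv_eqI)
  show "absv (fps_eval (f * g) w - fps_eval f w * fps_eval g w) \<le> absv w ^ N" for N
    using assms(1)
  proof (induction N arbitrary: f)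
    case 0
    have "absv (fps_eval f w * fps_eval g w) \<le> 1"
      unfolding absv_mult using 0 assms by (intro mult_le_one absv_fps_eval_le_1 absv_nonneg)
    then show ?case
      using absv_fps_eval_le_1[OF integral_fps_mult[OF 0 assms(2)] assms(3)] by (simp add: absv_diff_le)
  next
    case (Suc N)
    let ?h = "fps_shift 1 f"
    have h: "integral_fps ?h" using Suc.prems by (rule integral_fps_shift)
    have c: "absv (f $ 0) \<le> 1" using Suc.prems by (rule integral_fpsD)
    have "f * g = fps_const (f $ 0) * g + fps_X * (?h * g)"
      by (subst fps_decompose[of f]) (simp only: algebra_simps)
    then have "fps_eval (f * g) w = f $ 0 * fps_eval g w + w * fps_eval (?h * g) w"
      using h c assms by (simp add: fps_eval_add fps_eval_const_mult fps_eval_X_mult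
          integral_fps_mult integral_fps_const)
    then have "fps_eval (f * g) w - fps_eval f w * fps_eval g w
       = w * (fps_eval (?h * g) w - fps_eval ?h w * fps_eval g w)"
      using fps_eval_unfold[OF Suc.prems assms(3)] by (simp add: algebra_simps)
    then show ?case using Suc.IH[OF h] by (simp add: absv_mult mult_left_mono absv_nonneg)
  qed
qed (use assms in \<open>simp_all add: absv_nonneg\<close>)

lemma absv_fps_eval_le:
  assumes "integral_fps f" "f $ 0 = 0" "absv w < 1"
  shows "absv (fps_eval f w) \<le> absv w"
proof -
  have "absv w * absv (fps_eval (fps_shift 1 f) w) \<le> absv w"
    using absv_fps_eval_le_1[OF integral_fps_shift[OF assms(1), of 1] assms(3)]
    by (intro mult_left_le absv_nonneg)
  then show ?thesis using fps_eval_unfold[OF assms(1,3)] assms(2) by (simp add: absv_mult)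
qed

text \<open>The same induction as for products; the factor gained is now
  \<open>fps_eval g w\<close>, bounded by \<open>absv w\<close> because
  \<open>g $ 0 = 0\<close>.\<close>

lemma fps_eval_compose:
  fixes f g :: "'a::{ultrametric_field, complete_space} fps"
  assumes "integral_fps f" "integral_fps g" "g $ 0 = 0" "absv w < 1"
  shows "fps_eval (f oo g) w = fps_eval f (fps_eval g w)"
proof (rule absv_eqI)
  have y: "absv (fps_eval g w) \<le> absv w" using assms by (intro absv_fps_eval_le)
  then have y1: "absv (fps_eval g w) < 1" using assms(4) by linarith
  show "absv (fps_eval (f oo g) w - fps_eval f (fps_eval g w)) \<le> absv w ^ N" for N
    using assms(1)
  proof (induction N arbitrary: f)
    case 0
    then show ?case
      using absv_fps_eval_le_1[OF 0 y1] 
        absv_fps_eval_le_1[OF integral_fps_compose[OF 0 assms(2)] assms(4)] by (simp add: absv_diff_le)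
  next
    case (Suc N)
    let ?h = "fps_shift 1 f"
    have h: "integral_fps ?h" using Suc.prems by (rule integral_fps_shift)
    have c: "absv (f $ 0) \<le> 1" using Suc.prems by (rule integral_fpsD)
    have "f oo g = (fps_const (f $ 0) + fps_X * ?h) oo g" using fps_decompose[of f] by simp
    also have "\<dots> = fps_const (f $ 0) + g * (?h oo g)"
      using assms(3) by (simp add: fps_compose_add_distrib fps_compose_mult_distrib)
    finally have "fps_eval (f oo g) w = f $ 0 + fps_eval g w * fps_eval (?h oo g) w"
      using h c assms by (simp add: fps_eval_add fps_eval_mult fps_eval_const
          integral_fps_mult integral_fps_const integral_fps_compose)
    then have "fps_eval (f oo g) w - fps_eval f (fps_eval g w)
       = fps_eval g w * (fps_eval (?h oo g) w - fps_eval ?h (fps_eval g w))"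
      using fps_eval_unfold[OF Suc.prems y1] by (simp add: algebra_simps)
    moreover have "absv (fps_eval g w) * absv (fps_eval (?h oo g) w - fps_eval ?h (fps_eval g w))
      \<le> absv w * absv w ^ N"
      using y Suc.IH[OF h] by (intro mult_mono) (simp_all add: absv_nonneg)
    ultimately show ?case by (simp add: absv_mult)
  qed
qed (use assms in \<open>simp_all add: absv_nonneg\<close>)

lemma fps_eval_iterate:
  assumes "integral_fps f" "f $ 0 = 0" "absv w < 1"
  shows "fps_eval (fps_iterate f n) w = (fps_eval f ^^ n) w"
  using assms by (induction n) (simp_all add: fps_eval_compose integral_fps_iterate)

lemma absv_funpow_fps_eval_le:
  assumes "integral_fps f" "f $ 0 = 0" "absv w < 1"
  shows "absv ((fps_eval f ^^ n) w) \<le> absv w"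
  using absv_fps_eval_le[OF integral_fps_iterate[OF assms(1)] fps_iterate_nth_0[OF assms(2)] assms(3)]
  by (simp add: fps_eval_iterate assms)

lemma fps_eval_X_power_mult:
  assumes "integral_fps f" "absv w < 1"
  shows "fps_eval (fps_X ^ n * f) w = w ^ n * fps_eval f w"
  by (induction n)
    (simp_all add: assms fps_eval_X_mult integral_fps_mult integral_fps_power mult.assoc)

section \<open>Roots in the open unit disc\<close>

lemma fps_root_factor:
  fixes f :: "'a::{ultrametric_field, complete_space} fps"
  assumes f: "integral_fps f" and a: "absv a < 1" "fps_eval f a = 0"
  obtains g where "integral_fps g" "f = (fps_X - fps_const a) * g"
proof
  \<comment> \<open>Synthetic division: the \<open>n\<close>-th coefficient of the quotient is the
    sum over \<open>k\<close> of \<open>f $ (n + 1 + k) * a ^ k\<close>, and \<open>f(a) = 0\<close>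
    removes the remainder.\<close>
  define g where "g = Abs_fps (\<lambda>n. fps_eval (fps_shift (Suc n) f) a)"
  show "integral_fps g"
    using absv_fps_eval_le_1[OF integral_fps_shift[OF f] a(1)] by (simp add: integral_fps_def g_def)
  have unfold: "fps_eval (fps_shift n f) a = f $ n + a * fps_eval (fps_shift (Suc n) f) a" for n
  proof -
    have "fps_shift 1 (fps_shift n f) = fps_shift (Suc n) f" by (rule fps_ext) simp
    then show ?thesis using fps_eval_unfold[OF integral_fps_shift[OF f] a(1), of n] by simp
  qed
  show "f = (fps_X - fps_const a) * g"
  proof (rule fps_ext)
    fix n
    show "f $ n = ((fps_X - fps_const a) * g) $ n"
      using unfold[of n] a(2) by (cases n) (simp_all add: g_def left_diff_distrib eq_neg_iff_add_eq_0)
  qed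
qed

text \<open>Each root splits off a linear factor with constant term \<open>- a\<close>; the other
  roots, being distinct from \<open>a\<close>, pass to the quotient, which stays integral. What
  finally remains has a constant term of absolute value at most 1.\<close>

lemma absv_constant_term_le_prod_roots:
  fixes f :: "'a::{ultrametric_field, complete_space} fps"
  assumes "finite A" "integral_fps f" "\<And>a. a \<in> A \<Longrightarrow> absv a < 1 \<and> fps_eval f a = 0"
  shows "absv (f $ 0) \<le> (\<Prod>a\<in>A. absv a)"
  using assms
proof (induction A arbitrary: f rule: finite_induct)
  case empty
  then show ?case by (simp add: integral_fpsD)
next
  case (insert a A)
  obtain g where g: "integral_fps g" "f = (fps_X - fps_const a) * g"
    using fps_root_factor insert.prems by (metis insertI1)
  have a: "absv a < 1" using insert.prems by auto
  have "absv b < 1 \<and> fps_eval g b = 0" if "b \<in> A" for b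
  proof -
    have b: "absv b < 1" "fps_eval f b = 0" using that insert.prems by auto
    have "fps_eval f b = (b - a) * fps_eval g b"
      using a b g by (simp add: fps_eval_mult fps_eval_diff fps_eval_const integral_fps_diff integral_fps_const)
    then show ?thesis using b that insert.hyps by auto
  qed
  then have "absv (g $ 0) \<le> (\<Prod>a\<in>A. absv a)" using insert.IH g(1) by blast
  then show ?case using insert.hyps by (simp add: g(2) absv_mult mult_left_mono absv_nonneg)
qed

text \<open>
  \<open>G\<^sup>m - X = (G - X) S\<close> with \<open>S(0) = m\<close>, and \<open>m\<close> is a unit of the ring of integers when
  the characteristic does not divide it.
\<close>

lemma periodic_imp_fixed:
  fixes G :: "'a::{ultrametric_field, complete_space} fps"
  assumes p: "CHAR('a) > 0" "\<not> CHAR('a) dvd m"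
    and G: "integral_fps G" "G $ 0 = 0" "fps_X ^ 2 dvd G - fps_X"
    and w: "absv w < 1" "(fps_eval G ^^ m) w = w"
  shows "fps_eval G w = w"
proof -
  define v where "v = G - fps_X"
  \<comment> \<open>By construction \<open>\<delta>^(j+1) X = v * psi j\<close>, so the binomial
    expansion of the \<open>m\<close>-th iterate becomes \<open>X + v * S\<close>.\<close>
  define psi where "psi = (\<lambda>j. fps_diffquot G ((fps_increment G ^^ j) fps_X))"
  obtain m' where m: "m = Suc m'" using p(2) by (cases m) auto
  define S where "S = (\<Sum>j\<le>m'. of_nat (m choose Suc j) * psi j)"
  have psi: "integral_fps (psi j)" for j
    unfolding psi_def by (intro integral_fps_diffquot integral_fps_funpow_increment G) simp
  have S: "integral_fps S"
    unfolding S_def by (intro integral_fps_sum integral_fps_mult integral_fps_of_nat psi)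
  have v: "integral_fps v" unfolding v_def by (intro integral_fps_diff G) simp
  have "(fps_increment G ^^ Suc j) fps_X = v * psi j" for j
    by (simp add: fps_increment_eq[OF G(2)] v_def psi_def)
  then have "fps_iterate G m = fps_X + v * S"
    unfolding fps_iterate_conv_increment[OF G(2)] m S_def sum.atMost_Suc_shift
    by (simp add: sum_distrib_left mult_ac del: funpow.simps binomial_Suc_Suc)
  then have "fps_eval (v * S) w = 0"
    using w S v fps_eval_iterate[OF G(1,2) w(1), of m]
    by (simp add: fps_eval_add integral_fps_mult)
  \<comment> \<open>\<open>S(w)\<close> and \<open>S(0)\<close> differ by a multiple of
    \<open>w\<close>, so a zero at \<open>w\<close> would force
    \<open>absv (S $ 0) < 1\<close>.\<close>
  moreover have "fps_eval S w \<noteq> 0"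
  proof
    assume "fps_eval S w = 0"
    then have "S $ 0 + w * fps_eval (fps_shift 1 S) w = 0" using fps_eval_unfold[OF S w(1)] by simp
    then have "S $ 0 = - (w * fps_eval (fps_shift 1 S) w)" by (simp add: eq_neg_iff_add_eq_0)
    then have "absv (S $ 0) = absv w * absv (fps_eval (fps_shift 1 S) w)"
      by (simp add: absv_mult)
    also have "\<dots> \<le> absv w"
      using absv_fps_eval_le_1[OF integral_fps_shift[OF S, of 1] w(1)] by (intro mult_left_le absv_nonneg)
    finally have "absv (S $ 0) < 1" using w(1) by linarith
    \<comment> \<open>Each increment raises the order by at least one, so only \<open>j = 0\<close>
      contributes to \<open>S $ 0\<close>, with binomial coefficient \<open>m\<close>.\<close>
    moreover have "psi j $ 0 = (if j = 0 then 1 else 0)" for j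
    proof (cases j)
      case 0
      then show ?thesis by (simp add: psi_def fps_diffquot_def power_diffquot_def)
    next
      case (Suc j')
      have "fps_X ^ (1 + j * 1) dvd (fps_increment G ^^ j) fps_X"
        using G by (intro funpow_order fps_increment_order) (simp_all add: numeral_2_eq_2)
      then have "fps_X ^ (1 + j * 1 - 1) dvd psi j"
        unfolding psi_def by (intro fps_diffquot_order G)
      then show ?thesis using Suc by (simp add: fps_X_power_dvd_iff del: power_Suc)
    qed
    then have "(of_nat (m choose Suc j) * psi j) $ 0 = (if j = 0 then of_nat m else 0)" for j
      by (simp flip: fps_of_nat)
    then have "S $ 0 = of_nat m" by (simp add: S_def fps_sum_nth)
    ultimately show False using absv_of_nat_eq_1[OF p] by simp
  qed
  ultimately have "fps_eval v w = 0" using w(1) S v by (simp add: fps_eval_mult)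
  then show ?thesis using w(1) G(1) by (simp add: v_def fps_eval_diff)
qed

section \<open>Periodic points\<close>

lemma funpow_fixed_mult:
  assumes "(h ^^ a) w = w"
  shows "(h ^^ (a * b)) w = w"
  unfolding funpow_mult[symmetric] using assms by (induction b) simp_all

lemma fps_eq_X_power_mult_shift:
  "n \<le> subdegree f \<Longrightarrow> f = fps_X ^ n * fps_shift n f" for f :: "'a::comm_ring_1 fps"
  by (rule fps_ext) (auto simp: fps_X_power_mult_nth nth_less_subdegree_zero)

lemma fps_eval_eq_0_imp_fps_shift:
  assumes "integral_fps f" "n \<le> subdegree f" "absv w < 1" "w \<noteq> 0" "fps_eval f w = 0"
  shows "fps_eval (fps_shift n f) w = 0"
  using fps_eval_X_power_mult[OF integral_fps_shift[OF assms(1), of n] assms(3), of n]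
    fps_eq_X_power_mult_shift[OF assms(2)] assms(4,5) by simp

text \<open>\<open>g\<close> stands for the \<open>q\<close>-th iterate of the given series over the
  completion, and \<open>ram n\<close> for \<open>i_n\<close>, described by a recursion. The
  \<open>Suc\<close> in the subdegree appears because \<open>i_n\<close> is taken after division by
  \<open>X\<close>.\<close>

locale minimally_ramified_iterates =
  fixes g :: "'a::{ultrametric_field, complete_space} fps" and p q :: nat and ram :: "nat \<Rightarrow> nat"
  assumes p_def: "p = CHAR('a)"
    and CHAR_pos: "CHAR('a) > 0"
    and g: "integral_fps g" "g $ 0 = 0"
    and q: "0 < q" "ram 0 = q" "\<And>n. ram (Suc n) = p * ram n + q"
    and subdegree_iterate: "\<And>n. subdegree (fps_iterate g (p ^ n) - fps_X) = Suc (ram n)"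
begin

definition incr :: "nat \<Rightarrow> 'a fps" where
  "incr n = fps_iterate g (p ^ n) - fps_X"

definition lead :: "nat \<Rightarrow> 'a" where
  "lead n = incr n $ Suc (ram n)"

definition lead_ratio :: "nat \<Rightarrow> 'a" where
  "lead_ratio n = lead (Suc n) / lead n"

lemma prime_p: "prime p"
  unfolding p_def using CHAR_pos by (rule prime_CHAR_semidom)

lemma incr_nonzero: "incr n \<noteq> 0"
  using subdegree_iterate[of n] by (auto simp: incr_def)

lemma lead_nonzero: "lead n \<noteq> 0"
  using subdegree_iterate[of n] incr_nonzero[of n] unfolding lead_def incr_def
  by (metis nth_subdegree_nonzero)

lemma sub_incr: "subdegree (incr n) = Suc (ram n)"
  using subdegree_iterate by (simp add: incr_def)

lemma integral_incr: "integral_fps (incr n)"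
  unfolding incr_def by (intro integral_fps_diff integral_fps_iterate g) simp

lemma iterate_Suc: "fps_iterate g (p ^ Suc n) = fps_iterate (fps_iterate g (p ^ n)) p"
  by (simp add: fps_iterate_mult[OF g(2), symmetric] mult.commute)

text \<open>The start at 1 secures \<open>2 * q < ram n\<close>: \<open>ram 0\<close> is only
  \<open>q\<close>, whereas \<open>ram (Suc k)\<close> is at least \<open>p * q + q\<close>.\<close>

lemma lead_ratio_Suc:
  assumes "1 \<le> n"
  shows "lead_ratio (Suc n) = lead_ratio n ^ p"
proof -
  have "2 \<le> p" using prime_p by (rule prime_ge_2_nat)
  have "q \<le> ram k" for k using q by (cases k) auto
  obtain k where n: "n = Suc k" using assms by (cases n) auto
  have "2 * q < ram n"
  proof -
    have "2 * q \<le> p * ram k" using \<open>2 \<le> p\<close> \<open>q \<le> ram k\<close> by (rule mult_le_mono)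
    then show ?thesis using q by (simp add: n)
  qed
  have L: "incr (Suc (Suc n)) $ subdegree (incr (Suc (Suc n))) / incr (Suc n) $ subdegree (incr (Suc n))
    = (incr (Suc n) $ subdegree (incr (Suc n)) / incr n $ subdegree (incr n)) ^ p"
  proof (rule lead_coeff_iterates_CHAR[where 'a = 'a and G = "fps_iterate g (p ^ n)" and ?v0.0 = "incr n", folded p_def,
        OF prime_gt_0_nat[OF prime_p] _ q(1) \<open>2 * q < ram n\<close>])
    show "fps_iterate g (p ^ n) $ 0 = 0" using g by simp
    show "incr (Suc n) = fps_iterate (fps_iterate g (p ^ n)) p - fps_X"
      "incr (Suc (Suc n)) = fps_iterate (fps_iterate (fps_iterate g (p ^ n)) p) p - fps_X"
      by (simp_all only: incr_def iterate_Suc)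
    show "incr n = fps_iterate g (p ^ n) - fps_X" by (rule incr_def)
  qed (simp_all only: sub_incr q)
  show ?thesis
    using L by (simp only: sub_incr lead_ratio_def lead_def)
qed

lemma lead_ratio_eq: "lead_ratio (Suc n) = lead_ratio 1 ^ (p ^ n)"
  by (induction n) (simp_all add: lead_ratio_Suc mult.commute flip: power_mult)

lemma fixed_iff_incr:
  assumes "absv w < 1"
  shows "(fps_eval g ^^ (p ^ n)) w = w \<longleftrightarrow> fps_eval (incr n) w = 0"
  unfolding incr_def using assms g
  by (simp add: fps_eval_diff fps_eval_iterate integral_fps_iterate)

text \<open>With \<open>N = p^t * m\<close> and \<open>m\<close> prime to \<open>p\<close>, the
  point \<open>w\<close> has period \<open>m\<close> under the \<open>p^t\<close>-th iterate and is
  therefore fixed by it.\<close>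

lemma periodic_imp_power_periodic:
  assumes w: "absv w < 1" and N: "0 < N" "(fps_eval g ^^ N) w = w"
  obtains t where "p ^ t \<le> N" "(fps_eval g ^^ (p ^ t)) w = w"
proof -
  obtain m where m: "N = p ^ multiplicity p N * m" "\<not> p dvd m"
    by (rule multiplicity_decompose'[of N p]) (use N(1) prime_p in auto)
  define t where "t = multiplicity p N"
  have N_eq: "N = p ^ t * m" unfolding t_def by (rule m(1))
  let ?G = "fps_iterate g (p ^ t)"
  have "0 < ram t" using q by (cases t) auto
  then have "fps_X ^ 2 dvd incr t"
    using incr_nonzero[of t] sub_incr[of t] by (simp add: fps_dvd_iff)
  moreover have "(fps_eval ?G ^^ m) w = w"
    using N(2) w g unfolding N_eq
    by (simp add: fps_iterate_mult integral_fps_iterate flip: fps_eval_iterate)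
  ultimately have "fps_eval ?G w = w"
    using periodic_imp_fixed[of m ?G w] CHAR_pos m(2) w g
    by (simp add: incr_def integral_fps_iterate flip: p_def)
  then have "(fps_eval g ^^ (p ^ t)) w = w" using fps_eval_iterate[OF g w] by simp
  moreover have "p ^ t \<le> N" using N(1) N_eq by (intro dvd_imp_le) simp_all
  ultimately show thesis using that by blast
qed

lemma absv_lead_le:
  assumes w: "absv w < 1" "w \<noteq> 0" and "(fps_eval g ^^ (p ^ n)) w = w"
  shows "absv (lead n) \<le> absv w"
proof -
  have "fps_eval (fps_shift (Suc (ram n)) (incr n)) w = 0"
    using fixed_iff_incr[OF w(1)] assms
    by (intro fps_eval_eq_0_imp_fps_shift integral_incr) (auto simp: sub_incr)
  then show ?thesis
    using absv_constant_term_le_prod_roots[of "{w}" "fps_shift (Suc (ram n)) (incr n)"] w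
    by (simp add: integral_fps_shift integral_incr lead_def)
qed

text \<open>The orbit of \<open>w\<close> supplies \<open>p^(n+1)\<close> distinct zeros of
  \<open>Q = incr (n+1) / incr n\<close>, each of absolute value at most \<open>absv w\<close>, and
  the leading coefficient of \<open>Q\<close> is \<open>lead_ratio n\<close>.\<close>

lemma absv_lead_ratio_le:
  assumes w: "absv w < 1" "w \<noteq> 0"
    and per: "(fps_eval g ^^ (p ^ Suc n)) w = w" "(fps_eval g ^^ (p ^ n)) w \<noteq> w"
  shows "absv (lead_ratio n) \<le> absv w ^ (p ^ Suc n)"
proof -
  define P where "P = p ^ Suc n"
  define h where "h = fps_eval g"
  define G where "G = fps_iterate g (p ^ n)"
  have hP: "(h ^^ P) w = w" using per by (simp add: P_def h_def)
  have return: "(h ^^ (P - j)) ((h ^^ j) w) = w" if "j \<le> P" for j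
  proof -
    have "(h ^^ (P - j)) ((h ^^ j) w) = (h ^^ (P - j + j)) w" by (simp only: funpow_add comp_apply)
    then show ?thesis using hP that by simp
  qed
  have small: "absv ((h ^^ j) w) \<le> absv w" for j
    unfolding h_def by (intro absv_funpow_fps_eval_le g w(1))
  have small1: "absv ((h ^^ j) w) < 1" for j
    using small w(1) by (rule le_less_trans)
  \<comment> \<open>A coincidence would give \<open>w\<close> a period below \<open>P\<close>, hence
    a period \<open>p^t\<close> with \<open>t \<le> n\<close>, and then the excluded period
    \<open>p^n\<close>.\<close>
  have inj: "inj_on (\<lambda>j. (h ^^ j) w) {..<P}"
  proof (rule linorder_inj_onI')
    fix a b assume ab: "a \<in> {..<P}" "b \<in> {..<P}" "a < b"
    show "(h ^^ a) w \<noteq> (h ^^ b) w"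
    proof
      assume "(h ^^ a) w = (h ^^ b) w"
      then have "(h ^^ (P - b + a)) w = (h ^^ (P - b)) ((h ^^ b) w)"
        by (simp only: funpow_add comp_apply)
      also have "\<dots> = w" using return[of b] ab by simp
      finally obtain t where t: "p ^ t \<le> P - b + a" "(h ^^ (p ^ t)) w = w"
        using periodic_imp_power_periodic[OF w(1), of "P - b + a"] ab unfolding h_def by auto
      have "p ^ t < p ^ Suc n" using t(1) ab unfolding P_def[symmetric] by auto
      then have "t < Suc n" by (rule power_less_imp_less_exp[OF prime_gt_1_nat[OF prime_p]])
      then have "p ^ t * p ^ (n - t) = p ^ n" by (simp flip: power_add)
      then have "(h ^^ (p ^ n)) w = w" using funpow_fixed_mult[OF t(2)] by metis
      then show False using per(2) unfolding h_def by contradiction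
    qed
  qed
  obtain m where m: "p = Suc m" using prime_gt_0_nat[OF prime_p] gr0_implies_Suc by blast
  have G: "integral_fps G" "G $ 0 = 0" using g by (auto simp: G_def integral_fps_iterate)
  \<comment> \<open>Since \<open>\<delta>^p X\<close> is the increment of
    \<open>\<delta>^(p-1) X\<close>, it equals \<open>(G - X) * Q\<close>; this form shows that
    \<open>Q\<close> is integral.\<close>
  define Q where "Q = fps_diffquot G ((fps_increment G ^^ m) fps_X)"
  have Q: "integral_fps Q"
    unfolding Q_def by (intro integral_fps_diffquot integral_fps_funpow_increment G) simp
  have "incr (Suc n) = (fps_increment G ^^ p) fps_X"
    using fps_iterate_CHAR[OF CHAR_pos G(2)] by (simp add: incr_def iterate_Suc G_def del: power_Suc flip: p_def)
  then have incr_Suc: "incr (Suc n) = incr n * Q"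
  proof -
    have "(fps_increment G ^^ p) fps_X = fps_increment G ((fps_increment G ^^ m) fps_X)"
      unfolding m by simp
    moreover have "incr n = G - fps_X" by (simp only: incr_def G_def)
    ultimately show ?thesis
      using \<open>incr (Suc n) = _\<close> by (simp only: fps_increment_eq[OF G(2)] Q_def)
  qed
  define e where "e = subdegree Q"
  have "Q \<noteq> 0" using incr_Suc incr_nonzero[of "Suc n"] by auto
  then have "subdegree (incr (Suc n)) = Suc (ram n) + e"
    unfolding incr_Suc e_def using incr_nonzero[of n] sub_incr[of n]
    by simp
  then have "lead (Suc n) = incr (Suc n) $ (subdegree (incr n) + e)"
    using sub_incr by (simp add: lead_def)
  also have "\<dots> = lead n * Q $ e"
    unfolding incr_Suc e_def nth_subdegree_mult lead_def
    by (simp only: sub_incr)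
  finally have ratio: "lead_ratio n = Q $ e"
    using lead_nonzero[of n] by (simp add: lead_ratio_def)
  have root: "absv z < 1 \<and> fps_eval (fps_shift e Q) z = 0" if "z \<in> (\<lambda>j. (h ^^ j) w) ` {..<P}" for z
  proof -
    obtain j where j: "j < P" "z = (h ^^ j) w" using \<open>z \<in> _\<close> by auto
    have z: "absv z < 1" using small1 j by simp
    \<comment> \<open>The origin is fixed, so an orbit through it could not return to
      \<open>w\<close>. Hence \<open>z\<close> is nonzero and remains a zero when \<open>X^e\<close>
      is divided out of \<open>Q\<close>.\<close>
    have "(h ^^ k) 0 = 0" for k
    proof -
      have "absv ((h ^^ k) 0) \<le> 0" using absv_funpow_fps_eval_le[OF g, of 0 k] by (simp add: h_def)
      then show ?thesis using absv_pos_iff[of "(h ^^ k) 0"] by force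
    qed
    then have "z \<noteq> 0" using return[of j] j w by auto
    have "(h ^^ P) z = z"
    proof -
      have "(h ^^ P) z = (h ^^ (j + P)) w"
        by (subst add.commute) (simp add: funpow_add j)
      then show ?thesis using hP j by (simp add: funpow_add)
    qed
    then have "fps_eval (incr (Suc n)) z = 0"
      using fixed_iff_incr[OF z, of "Suc n"] by (simp only: P_def h_def)
    \<comment> \<open>If the \<open>p^n\<close>-th iterate fixed \<open>z\<close>, following the
      orbit from \<open>z\<close> back to \<open>w\<close> would show that it fixes
      \<open>w\<close>.\<close>
    moreover have "fps_eval (incr n) z \<noteq> 0"
    proof
      assume "fps_eval (incr n) z = 0"
      then have "(h ^^ p ^ n) z = z" using fixed_iff_incr[OF z] by (simp add: h_def)
      then have "(h ^^ (P - j)) z = (h ^^ (P - j + p ^ n)) z" by (simp add: funpow_add)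
      also have "\<dots> = (h ^^ p ^ n) ((h ^^ (P - j)) z)"
        by (subst add.commute) (simp add: funpow_add)
      finally show False using return[of j] j per(2) by (simp add: h_def)
    qed
    ultimately have "fps_eval Q z = 0"
      unfolding incr_Suc using z Q integral_incr by (simp add: fps_eval_mult)
    then have "fps_eval (fps_shift e Q) z = 0"
      using fps_eval_eq_0_imp_fps_shift[OF Q _ z \<open>z \<noteq> 0\<close>] by (simp add: e_def)
    then show ?thesis using z by simp
  qed
  have "absv (lead_ratio n) = absv (fps_shift e Q $ 0)" by (simp add: ratio)
  also have "\<dots> \<le> (\<Prod>z\<in>(\<lambda>j. (h ^^ j) w) ` {..<P}. absv z)"
    using root by (intro absv_constant_term_le_prod_roots integral_fps_shift Q) auto
  also have "\<dots> = (\<Prod>j<P. absv ((h ^^ j) w))"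
    by (simp add: prod.reindex[OF inj])
  also have "\<dots> \<le> (\<Prod>j<P. absv w)"
    by (intro prod_mono conjI small absv_nonneg)
  finally show ?thesis by (simp add: P_def)
qed

text \<open>Periods 1 and \<open>p\<close> are bounded through \<open>lead 1\<close>, since the
  power law for the ratios starts at index 1; all longer periods are bounded through
  \<open>lead_ratio 1\<close>.\<close>

lemma periodic_lower_bound:
  assumes w: "absv w < 1" "w \<noteq> 0" and N: "0 < N" "(fps_eval g ^^ N) w = w"
  shows "min (absv (lead 1)) (absv (lead_ratio 1)) \<le> absv w"
proof -
  define Per where "Per = (\<lambda>t. (fps_eval g ^^ (p ^ t)) w = w)"
  have "\<exists>t. Per t" using periodic_imp_power_periodic[OF w(1) N] unfolding Per_def by blast
  then obtain s where s: "Per s" "\<And>t. t < s \<Longrightarrow> \<not> Per t" using exists_least_iff[of Per] by blast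
  show ?thesis
  proof (cases "s \<le> 1")
    case True
    have "(fps_eval g ^^ (p ^ s * p ^ (1 - s))) w = w"
      using s(1) unfolding Per_def by (rule funpow_fixed_mult)
    moreover have "p ^ s * p ^ (1 - s) = p ^ 1" using True by (simp only: flip: power_add) simp
    ultimately have "absv (lead 1) \<le> absv w" by (intro absv_lead_le w) simp
    then show ?thesis by simp
  next
    case False
    then obtain m where m: "s = Suc (Suc m)" by (metis One_nat_def not_less_eq_eq old.nat.exhaust zero_le)
    have "absv (lead_ratio (Suc m)) \<le> absv w ^ (p ^ Suc (Suc m))"
      by (intro absv_lead_ratio_le w) (use s(1) s(2)[of "Suc m"] m in \<open>simp_all add: Per_def\<close>)
    then have "absv (lead_ratio 1) ^ (p ^ m) \<le> absv w ^ (p ^ Suc (Suc m))"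
      unfolding lead_ratio_eq[of m] absv_power .
    \<comment> \<open>Both sides become \<open>p^m\<close>-th powers; taking the root removes the
      dependence on the period.\<close>
    also have "\<dots> = (absv w ^ p ^ 2) ^ (p ^ m)"
      by (simp add: power2_eq_square mult_ac flip: power_mult)
    finally have "absv (lead_ratio 1) ^ (p ^ m) \<le> (absv w ^ p ^ 2) ^ (p ^ m)" .
    then have "absv (lead_ratio 1) \<le> absv w ^ p ^ 2"
      using prime_gt_0_nat[OF prime_p] by (simp add: power_mono_iff absv_nonneg)
    also have "\<dots> \<le> absv w ^ 1"
      using prime_gt_0_nat[OF prime_p] w by (intro power_decreasing) (simp_all add: absv_nonneg)
    finally show ?thesis by simp
  qed
qed

end

section \<open>Transfer of power series to the completion\<close>

definition fps_map :: "('a \<Rightarrow> 'b) \<Rightarrow> 'a fps \<Rightarrow> 'b fps" where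
  "fps_map \<phi> f = Abs_fps (\<lambda>n. \<phi> (f $ n))"

lemma fps_map_nth [simp]: "fps_map \<phi> f $ n = \<phi> (f $ n)"
  by (simp add: fps_map_def)

locale field_embedding =
  fixes \<phi> :: "'a::field \<Rightarrow> 'b::field"
  assumes map_1 [simp]: "\<phi> 1 = 1"
    and map_add: "\<phi> (x + y) = \<phi> x + \<phi> y"
    and map_mult: "\<phi> (x * y) = \<phi> x * \<phi> y"
begin

sublocale additive \<phi>
  by unfold_locales (rule map_add)

lemmas map_0 [simp] = zero

lemma map_eq_0_iff [simp]: "\<phi> x = 0 \<longleftrightarrow> x = 0"
  using map_mult[of x "inverse x"] by (cases "x = 0") auto

lemma map_of_nat: "\<phi> (of_nat n) = of_nat n"
  by (induction n) (simp_all add: map_add)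

lemma CHAR_eq: "CHAR('b) = CHAR('a)"
proof (rule CHAR_eqI)
  fix n assume "of_nat n = (0 :: 'b)"
  then have "\<phi> (of_nat n) = 0" by (simp only: map_of_nat)
  then show "CHAR('a) dvd n" by (simp add: of_nat_eq_0_iff_char_dvd)
next
  show "of_nat CHAR('a) = (0 :: 'b)" using map_of_nat[of "CHAR('a)"] by simp
qed

lemma fps_map_X: "fps_map \<phi> fps_X = fps_X"
  by (rule fps_ext) (simp add: fps_X_def)

lemma fps_map_diff: "fps_map \<phi> (f - g) = fps_map \<phi> f - fps_map \<phi> g"
  by (rule fps_ext) (simp add: diff)

lemma fps_map_mult: "fps_map \<phi> (f * g) = fps_map \<phi> f * fps_map \<phi> g"
  by (rule fps_ext) (simp add: fps_mult_nth sum map_mult)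

lemma fps_map_power: "fps_map \<phi> (f ^ n) = fps_map \<phi> f ^ n"
proof (induction n)
  case 0
  show ?case by (rule fps_ext) simp
qed (simp add: fps_map_mult)

lemma fps_map_compose: "fps_map \<phi> (f oo g) = fps_map \<phi> f oo fps_map \<phi> g"
  by (rule fps_ext) (simp add: fps_compose_nth sum map_mult flip: fps_map_power)

lemma fps_map_iterate: "fps_map \<phi> (fps_iterate f n) = fps_iterate (fps_map \<phi> f) n"
  by (induction n) (simp_all add: fps_map_X fps_map_compose)

lemma subdegree_fps_map: "subdegree (fps_map \<phi> f) = subdegree f"
proof (cases "f = 0")
  case True
  then have "fps_map \<phi> f = 0" by (auto intro: fps_ext)
  then show ?thesis using True by simp
next
  case False
  then show ?thesis by (intro subdegreeI) auto
qed

end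

text \<open>A finite order excludes \<open>h = 0\<close>, and division by \<open>X\<close> lowers
  the order by one.\<close>

lemma subdegree_eq_of_fps_ord_divide_X:
  fixes h :: "'a::field fps"
  assumes "h $ 0 = 0" "fps_ord (h / fps_X) = enat i"
  shows "subdegree h = Suc i"
proof -
  have h: "h = fps_X * fps_shift 1 h" using fps_decompose[of h] assms(1) by simp
  then have "h / fps_X = fps_shift 1 h" by (metis fps_X_neq_zero nonzero_mult_div_cancel_left)
  then have "fps_shift 1 h \<noteq> 0" "subdegree (fps_shift 1 h) = i"
    using assms(2) by (auto simp: fps_ord_def split: if_splits)
  then show ?thesis by (subst h) (simp add: subdegree_mult)
qed

text \<open>Both quotients are geometric sums; multiplied by \<open>q\<close>, the identity is the
  recursion for \<open>ram\<close>.\<close>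

lemma geometric_sum_div_Suc:
  fixes p :: nat
  assumes "2 \<le> p"
  shows "(p ^ (Suc n + 1) - 1) div (p - 1) = p * ((p ^ (n + 1) - 1) div (p - 1)) + 1"
proof -
  have eq: "(p ^ (n + 1) - 1) div (p - 1) = (\<Sum>j\<le>n. p ^ j)" for n
  proof -
    obtain r where r: "p = Suc r" using assms by (cases p) auto
    have "r * (\<Sum>j\<le>n. p ^ j) + 1 = p ^ (n + 1)"
      by (induction n) (simp_all add: r algebra_simps)
    then have "p ^ (n + 1) - 1 = r * (\<Sum>j\<le>n. p ^ j)" by linarith
    then show ?thesis using assms r by simp
  qed
  show ?thesis unfolding eq sum.atMost_Suc_shift by (simp add: sum_distrib_left)
qed

theorem corollaryC:
  fixes \<iota> :: "'a::ultrametric_field \<Rightarrow> 'b::{ultrametric_field, complete_space}"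
    and f :: "'a fps"
  assumes "CHAR('a) > 0"
    and "is_completion \<iota>"
    and "\<forall>n. fps_nth f n \<in> ring_of_integers"
    and "parabolic f"
    and "minimally_ramified f"
  shows "\<exists>\<epsilon>>0. \<forall>z \<in> (maximal_ideal :: 'a set).
           0 < absv z \<and> absv z < \<epsilon> \<longrightarrow> \<not> periodic_point \<iota> f (\<iota> z)"
proof -
  have absv_iota: "absv (\<iota> x) = absv x" for x using assms(2) by (simp add: is_completion_def)
  interpret \<iota>: field_embedding \<iota>
    using assms(2) by unfold_locales (simp_all add: is_completion_def)
  define p where "p = CHAR('a)"
  define q where "q = multiplier_order f"
  define F where "F = fps_map \<iota> f"
  have f0: "f $ 0 = 0" and "\<exists>m\<ge>1. (fps_deriv f $ 0) ^ m = 1"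
    using assms(4) unfolding parabolic_def by blast+
  then have "0 < q"
    unfolding q_def multiplier_order_def
    using LeastI_ex[of "\<lambda>m. 1 \<le> m \<and> (fps_deriv f $ 0) ^ m = 1"] by simp
  have F: "integral_fps F" "F $ 0 = 0"
    using assms(3) f0 by (simp_all add: F_def integral_fps_def ring_of_integers_def absv_iota)
  have "2 \<le> p" unfolding p_def using assms(1) by (intro prime_ge_2_nat prime_CHAR_semidom)
  define ram where "ram = (\<lambda>n. q * ((p ^ (n + 1) - 1) div (p - 1)))"
  have "subdegree (fps_iterate (fps_iterate f q) (p ^ n) - fps_X) = Suc (ram n)" for n
    using assms(5) f0 unfolding minimally_ramified_def ramification_number_def Let_def
    by (intro subdegree_eq_of_fps_ord_divide_X) (simp_all add: p_def q_def ram_def)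
  then have sub: "subdegree (fps_iterate (fps_iterate F q) (p ^ n) - fps_X) = Suc (ram n)" for n
    using \<iota>.subdegree_fps_map[of "fps_iterate (fps_iterate f q) (p ^ n) - fps_X"]
    by (simp add: F_def \<iota>.fps_map_X \<iota>.fps_map_diff \<iota>.fps_map_iterate)
  have ram: "ram 0 = q" "ram (Suc n) = p * ram n + q" for n
    using \<open>2 \<le> p\<close> unfolding ram_def geometric_sum_div_Suc[OF \<open>2 \<le> p\<close>]
    by (simp_all add: add_mult_distrib2)
  interpret minimally_ramified_iterates "fps_iterate F q" p q ram
  proof
    show "p = CHAR('b)" "0 < CHAR('b)" using assms(1) by (simp_all add: p_def \<iota>.CHAR_eq)
  qed (use F \<open>0 < q\<close> ram sub in \<open>simp_all add: integral_fps_iterate\<close>)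
  define \<epsilon> where "\<epsilon> = min (absv (lead 1)) (absv (lead_ratio 1))"
  have "0 < \<epsilon>"
    using lead_nonzero by (simp add: \<epsilon>_def lead_ratio_def absv_pos_iff)
  moreover have "\<not> periodic_point \<iota> f (\<iota> z)" if z: "0 < absv z" "absv z < \<epsilon>" for z
  proof
    assume "periodic_point \<iota> f (\<iota> z)"
    moreover have "fps_action \<iota> f = fps_eval F"
      by (simp add: fun_eq_iff fps_action_def fps_eval_def F_def)
    ultimately obtain N where N: "1 \<le> N" "(fps_eval F ^^ N) (\<iota> z) = \<iota> z" and small: "absv (\<iota> z) < 1"
      by (auto simp: periodic_point_def maximal_ideal_def)
    \<comment> \<open>Multiplying by \<open>q\<close> turns a period \<open>N\<close> of
      \<open>F\<close> into a period \<open>N\<close> of its \<open>q\<close>-th iterate.\<close>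
    have "(fps_eval F ^^ (N * q)) (\<iota> z) = \<iota> z" using N(2) by (rule funpow_fixed_mult)
    then have "(fps_eval (fps_iterate F q) ^^ N) (\<iota> z) = \<iota> z"
      using F small
      by (simp add: fps_iterate_mult mult.commute[of N] integral_fps_iterate flip: fps_eval_iterate)
    then have "\<epsilon> \<le> absv (\<iota> z)"
      unfolding \<epsilon>_def using small N(1) z by (intro periodic_lower_bound) (auto simp: absv_pos_iff)
    then show False using z by (simp add: absv_iota)
  qed
  ultimately show ?thesis by blast
qed

end
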